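(* Let $n\ge 3$, $R>0$, $B_R:=\{(x,y)\in\mathbb R^2: x^2+y^2\le R^2\}$, and let the minimal graph $$X(x,y)=\big(x,y,\varphi_1(x,y),\ldots,\varphi_{n-2}(x,y)\big),\qquad \varphi_\Sigma\in C^3(B_R,\mathbb R),\ \Sigma=1,\ldots,n-2,$$ in $\mathbb R^n$ be parametrized in conformal parameters $(u,v)\in B:=\{(u,v)\in\mathbb R^2:u^2+v^2\le 1\}$. Then there is a universal constant $\Theta\in[0,+\infty)$ such that for its Gaussian curvature $K_N$ along any unit normal section $N$ of the frame $\{X_u,X_v,N_1,\ldots,N_{n-2}\}$ it holds $$|K_N(0,0)|\le\frac{\Theta}{R^4}\,\|X\|_{C^0(B_R)}^2,\qquad \|X\|_{C^0(B_R)}:=\sup_{(x,y)\in B_R}|X(x,y)|,$$ where $(0,0)$ on the left-hand side denotes the origin of $B$.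
   Context: Parametrizing the graph in conformal parameters means representing it as an immersion $X=X(u,v)$ of class $C^3(B,\mathbb R^n)$ (a reparametrization of the graph over $B$) such that $|X_u|^2=W=|X_v|^2$ and $X_u\cdot X_v=0$ in $B$. Here $g_{ij}:=X_{u^i}\cdot X_{u^j}$ with $u^1=u$, $u^2=v$, and $W:=\sqrt{g_{11}g_{22}-g_{12}^2}>0$ is the surface area element. The graph is minimal if its mean curvature vector vanishes identically; in conformal parameters this means $\triangle X=X_{uu}+X_{vv}=0$ in $B$. The frame $\{X_u,X_v,N_1,\ldots,N_{n-2}\}$ consists of the two tangential vectors $X_u,X_v$ and an orthonormal system $N_1,\ldots,N_{n-2}$ in the normal space of $X$. A unit normal section $N$ is a field of unit vectors in the normal space, i.e. $|N|=1$ and $N\cdot X_u=N\cdot X_v=0$. The Gaussian curvature along $N$ is $$K_N:=\frac{L_{N,11}L_{N,22}-L_{N,12}^2}{W^2},\qquad L_{N,ij}:=X_{u^iu^j}\cdot N .$$ $|\cdot|$ denotes the Euclidean norm. "Universal" means that $\Theta$ does not depend on the particular surface, on $R$, or on $N$.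
   Formalization: The conformal parameters are additionally assumed to send the origin of B to the centre of B_R; without this the claim fails, e.g. for the graph of z^k/k over the unit disc precomposed with a disc automorphism sending 0 near the boundary. *)

theory Defs
  imports "HOL-Analysis.Analysis"
begin

text \<open>
  Points of the parameter plane have type \<open>real \<times> real\<close>, whose norm is the Euclidean one, so
  \<open>cball 0 R\<close> is the closed disc of radius \<open>R\<close> about the origin.  A vector of $n$-space is a
  function \<open>nat \<Rightarrow> real\<close> of which only the coordinates \<open>1, \<dots>, n\<close> matter.  The dimension
  is a term and not a type, since the constant of the theorem is to be chosen before \<open>n\<close>.
\<close>

type_synonym vec_n = "nat \<Rightarrow> real"

definition dot :: "nat \<Rightarrow> vec_n \<Rightarrow> vec_n \<Rightarrow> real" where
  "dot n a b = (\<Sum>i = 1..n. a i * b i)"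

definition enorm :: "nat \<Rightarrow> vec_n \<Rightarrow> real" where
  "enorm n a = sqrt (dot n a a)"

text \<open>
  Partial derivatives are values of the Frechet derivative relative to \<open>S\<close>.  On a closed disc
  of positive radius this derivative is unique, also at boundary points (where a coordinate line
  may meet the disc in one point only), and it depends only on the values of the function on \<open>S\<close>.
\<close>

definition pdiff :: "(real \<times> real) set \<Rightarrow> nat \<Rightarrow> (real \<times> real \<Rightarrow> real) \<Rightarrow> real \<times> real \<Rightarrow> real" where
  "pdiff S j f z = frechet_derivative f (at z within S) (if j = 1 then (1, 0) else (0, 1))"

text \<open>
  The class $C^k$ on a closed disc \<open>S\<close>: all derivatives up to order \<open>k\<close> exist relative to \<open>S\<close>
  and are continuous up to the boundary.
\<close>

fun Ck_on :: "nat \<Rightarrow> (real \<times> real) set \<Rightarrow> (real \<times> real \<Rightarrow> real) \<Rightarrow> bool" where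
  "Ck_on 0 S f \<longleftrightarrow> continuous_on S f"
| "Ck_on (Suc k) S f \<longleftrightarrow>
     f differentiable_on S \<and> Ck_on k S (pdiff S 1 f) \<and> Ck_on k S (pdiff S 2 f)"

definition vdiff :: "(real \<times> real) set \<Rightarrow> nat \<Rightarrow> (real \<times> real \<Rightarrow> vec_n) \<Rightarrow> real \<times> real \<Rightarrow> vec_n" where
  "vdiff S j X z = (\<lambda>i. pdiff S j (\<lambda>w. X w i) z)"

definition vdiff2 ::
    "(real \<times> real) set \<Rightarrow> nat \<Rightarrow> nat \<Rightarrow> (real \<times> real \<Rightarrow> vec_n) \<Rightarrow> real \<times> real \<Rightarrow> vec_n" where
  "vdiff2 S j k X = vdiff S k (vdiff S j X)"

definition gform ::
    "nat \<Rightarrow> (real \<times> real) set \<Rightarrow> (real \<times> real \<Rightarrow> vec_n) \<Rightarrow> nat \<Rightarrow> nat \<Rightarrow> real \<times> real \<Rightarrow> real" where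
  "gform n S X j k z = dot n (vdiff S j X z) (vdiff S k X z)"

definition area_element ::
    "nat \<Rightarrow> (real \<times> real) set \<Rightarrow> (real \<times> real \<Rightarrow> vec_n) \<Rightarrow> real \<times> real \<Rightarrow> real" where
  "area_element n S X z = sqrt (gform n S X 1 1 z * gform n S X 2 2 z - (gform n S X 1 2 z)\<^sup>2)"

text \<open>
  The component of \<open>v\<close> orthogonal to both tangential vectors: \<open>v\<close> minus the sum of
  $g^{jk} (v \cdot X_{u^k}) X_{u^j}$, with the inverse of the first fundamental form written out.
\<close>

definition normal_part ::
    "nat \<Rightarrow> (real \<times> real) set \<Rightarrow> (real \<times> real \<Rightarrow> vec_n) \<Rightarrow> real \<times> real \<Rightarrow> vec_n \<Rightarrow> vec_n" where
  "normal_part n S X z v =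
    (let g = (\<lambda>j k. gform n S X j k z);
         d = (area_element n S X z)\<^sup>2;
         a = dot n v (vdiff S 1 X z);
         b = dot n v (vdiff S 2 X z)
     in (\<lambda>i. v i - (g 2 2 * a - g 1 2 * b) / d * vdiff S 1 X z i
                 - (g 1 1 * b - g 1 2 * a) / d * vdiff S 2 X z i))"

text \<open>
  Half the trace, with respect to the first fundamental form, of the normal part of the second
  derivatives.  Its inner product with a unit normal \<open>N\<close> is the mean curvature along \<open>N\<close>,
  $(L_{N,11} g_{22} - 2 L_{N,12} g_{12} + L_{N,22} g_{11}) / (2 W^2)$.
\<close>

definition mean_curvature_vector ::
    "nat \<Rightarrow> (real \<times> real) set \<Rightarrow> (real \<times> real \<Rightarrow> vec_n) \<Rightarrow> real \<times> real \<Rightarrow> vec_n" where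
  "mean_curvature_vector n S X z =
    normal_part n S X z
      (\<lambda>i. (gform n S X 2 2 z * vdiff2 S 1 1 X z i
            - 2 * gform n S X 1 2 z * vdiff2 S 1 2 X z i
            + gform n S X 1 1 z * vdiff2 S 2 2 X z i) / (2 * (area_element n S X z)\<^sup>2))"

definition minimal_surface ::
    "nat \<Rightarrow> (real \<times> real) set \<Rightarrow> (real \<times> real \<Rightarrow> vec_n) \<Rightarrow> bool" where
  "minimal_surface n S X \<longleftrightarrow> (\<forall>z\<in>S. \<forall>i\<in>{1..n}. mean_curvature_vector n S X z i = 0)"

definition graph_map :: "(nat \<Rightarrow> real \<times> real \<Rightarrow> real) \<Rightarrow> real \<times> real \<Rightarrow> vec_n" where
  "graph_map \<phi> p = (\<lambda>i. if i = 1 then fst p else if i = 2 then snd p else \<phi> (i - 2) p)"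

definition C0_norm ::
    "nat \<Rightarrow> (real \<times> real) set \<Rightarrow> (real \<times> real \<Rightarrow> vec_n) \<Rightarrow> real" where
  "C0_norm n S X = (SUP p\<in>S. enorm n (X p))"

text \<open>
  \<open>Y\<close> represents the surface \<open>X\<close> over \<open>T\<close> as a conformally parametrized immersion over \<open>S\<close>.
  The parameter change \<open>F\<close> is only required to be bijective: for a graph \<open>X\<close> it consists
  of the first two coordinates of \<open>Y\<close>, so its smoothness and that of its inverse follow from
  the regularity and the immersion property of \<open>Y\<close>.
\<close>

definition conformal_reparam ::
    "nat \<Rightarrow> (real \<times> real) set \<Rightarrow> (real \<times> real \<Rightarrow> vec_n) \<Rightarrow>
     (real \<times> real) set \<Rightarrow> (real \<times> real \<Rightarrow> vec_n) \<Rightarrow> (real \<times> real \<Rightarrow> real \<times> real) \<Rightarrow> bool" where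
  "conformal_reparam n T X S Y F \<longleftrightarrow>
     bij_betw F S T \<and>
     (\<forall>z\<in>S. \<forall>i\<in>{1..n}. Y z i = X (F z) i) \<and>
     (\<forall>i\<in>{1..n}. Ck_on 3 S (\<lambda>z. Y z i)) \<and>
     (\<forall>z\<in>S. area_element n S Y z > 0 \<and>
            (enorm n (vdiff S 1 Y z))\<^sup>2 = area_element n S Y z \<and>
            (enorm n (vdiff S 2 Y z))\<^sup>2 = area_element n S Y z \<and>
            dot n (vdiff S 1 Y z) (vdiff S 2 Y z) = 0)"

definition unit_normal_section ::
    "nat \<Rightarrow> (real \<times> real) set \<Rightarrow> (real \<times> real \<Rightarrow> vec_n) \<Rightarrow> (real \<times> real \<Rightarrow> vec_n) \<Rightarrow> bool" where
  "unit_normal_section n S X N \<longleftrightarrow>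
     (\<forall>z\<in>S. enorm n (N z) = 1 \<and> dot n (N z) (vdiff S 1 X z) = 0 \<and> dot n (N z) (vdiff S 2 X z) = 0)"

definition Lform ::
    "nat \<Rightarrow> (real \<times> real) set \<Rightarrow> (real \<times> real \<Rightarrow> vec_n) \<Rightarrow> (real \<times> real \<Rightarrow> vec_n) \<Rightarrow>
     nat \<Rightarrow> nat \<Rightarrow> real \<times> real \<Rightarrow> real" where
  "Lform n S X N j k z = dot n (vdiff2 S j k X z) (N z)"

definition gauss_curvature ::
    "nat \<Rightarrow> (real \<times> real) set \<Rightarrow> (real \<times> real \<Rightarrow> vec_n) \<Rightarrow> (real \<times> real \<Rightarrow> vec_n) \<Rightarrow>
     real \<times> real \<Rightarrow> real" where
  "gauss_curvature n S X N z =
     (Lform n S X N 1 1 z * Lform n S X N 2 2 z - (Lform n S X N 1 2 z)\<^sup>2)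
       / (area_element n S X z)\<^sup>2"

end

theory Submission
  imports Defs "HOL-Complex_Analysis.Complex_Analysis"
begin

text \<open>
  Minimality and conformality together make \<open>Y\<close> a harmonic map (lemma
  \<open>conformal_minimal_harmonic\<close>): conformality puts the Laplacian of \<open>Y\<close>
  into the normal space, and there it is a multiple of the mean curvature vector. At the origin the
  curvature along \<open>N\<close> is a quotient, and harmonicity bounds its numerator
  above and its denominator below.

  The numerator involves second derivatives of the harmonic function \<open>Y \<bullet> N 0\<close>,
  which is bounded by the norm \<open>M\<close> of the surface. It is the real part of a holomorphic
  function, and Cauchy's estimates (lemma
  \<open>cauchy_second_derivative_of_bounded_real_part\<close>) bound the numerator by a multiple of
  \<open>M\<^sup>2\<close>.

  The denominator is \<open>W\<^sup>2\<close>, and \<open>2 W\<close> is at least the squared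
  gradient of each of the first two components of \<open>Y\<close>. These form a harmonic
  homeomorphism \<open>F\<close> from the unit disc onto the disc of radius \<open>R\<close> that
  fixes the origin, and Heinz's lemma (lemma \<open>heinz_lower_bound\<close>) says that its
  gradient at the origin is at least a multiple of \<open>R\<close>. Each coordinate
  \<open>h\<close> of \<open>F\<close> is positive on one arc of the unit circle and negative on the
  complementary one, so \<open>h\<close> has on the circle the sign of \<open>cos \<theta> -
  \<kappa>\<close> in a suitably rotated angle (lemma \<open>real_part_sign_on_circle\<close>).
  Since \<open>h\<close> vanishes at the origin, the integral of \<open>h (cos \<theta> -
  \<kappa>)\<close> is \<open>pi\<close> times a directional derivative of \<open>h\<close> at the
  origin (lemma \<open>boundary_integral_gradient\<close>), and its integrand is nonnegative. It can
  be small only if \<open>h\<close> is concentrated where \<open>cos \<theta>\<close> is near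
  \<open>\<kappa>\<close>; this is excluded for one of the coordinates, because on the circle they
  are bounded by \<open>R\<close> and their absolute values add up to at least \<open>R\<close>.

  Altogether the curvature is at most \<open>(396 M)\<^sup>2 / (R\<^sup>2 / 288)\<^sup>2\<close>.
\<close>

section \<open>Holomorphic functions with bounded real part\<close>

text \<open>
  Cauchy's estimates need a bound on the function itself, while only its real part is controlled.
  The exponential \<open>e = exp (p / M)\<close> has modulus \<open>exp (Re p / M)\<close>, hence
  between \<open>1/3\<close> and \<open>3\<close>; the estimates for \<open>e'\<close> and
  \<open>e''\<close> on the disc of radius \<open>1/2\<close> give those for \<open>p'\<close> and
  \<open>p''\<close>, because \<open>e' = (p'/M) e\<close> and \<open>e'' = (p''/M + (p'/M)\<^sup>2)
  e\<close>.
\<close>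

lemma cauchy_second_derivative_of_bounded_real_part:
  fixes p :: "complex \<Rightarrow> complex"
  assumes holo: "p holomorphic_on ball 0 1" and M: "0 < M"
    and bound: "\<And>z. z \<in> ball 0 1 \<Longrightarrow> \<bar>Re (p z)\<bar> \<le> M"
  shows "cmod (deriv (deriv p) 0) \<le> 396 * M"
proof -
  define e where "e = (\<lambda>z. exp (p z / of_real M))"
  have e3: "exp 1 \<le> (3::real)" by (rule exp_le)
  have e_holo: "e holomorphic_on ball 0 1"
    unfolding e_def using holo M by (intro holomorphic_intros) auto
  have norm_e: "cmod (e z) \<le> 3" and norm_e_inv: "1 / 3 \<le> cmod (e z)" if "z \<in> ball 0 1" for z
  proof -
    have "\<bar>Re (p z) / M\<bar> \<le> 1" using bound[OF that] M by simp
    then have "- 1 \<le> Re (p z) / M" "Re (p z) / M \<le> 1" by linarith+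
    then have "exp (-1) \<le> exp (Re (p z) / M)" "exp (Re (p z) / M) \<le> exp 1" by simp_all
    moreover have "exp (-1::real) \<ge> 1/3" using e3 by (simp add: exp_minus field_simps)
    ultimately have "exp (Re (p z) / M) \<le> 3" "1 / 3 \<le> exp (Re (p z) / M)" using e3 by linarith+
    then show "cmod (e z) \<le> 3" "1 / 3 \<le> cmod (e z)" by (simp_all add: e_def)
  qed
  have cauchy: "cmod ((deriv ^^ k) e 0) \<le> fact k * 3 / (1/2) ^ k" for k
  proof (rule Cauchy_inequality)
    show "e holomorphic_on ball 0 (1/2)" by (rule holomorphic_on_subset[OF e_holo]) auto
    show "continuous_on (cball 0 (1/2)) e"
      by (rule holomorphic_on_imp_continuous_on, rule holomorphic_on_subset[OF e_holo]) auto
  qed (auto intro!: norm_e)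
  have p_deriv: "(p has_field_derivative deriv p z) (at z)" if "z \<in> ball 0 1" for z
    using holo that by (auto intro: holomorphic_derivI)
  have p_deriv2: "(deriv p has_field_derivative deriv (deriv p) 0) (at 0)"
    using holo by (auto intro!: holomorphic_derivI holomorphic_deriv)
  have e_deriv: "(e has_field_derivative (deriv p z / of_real M) * e z) (at z)" if "z \<in> ball 0 1" for z
    unfolding e_def using M by (auto intro!: derivative_eq_intros p_deriv that)
  then have deriv_e: "deriv e z = (deriv p z / of_real M) * e z" if "z \<in> ball 0 1" for z
    using that by (auto intro: DERIV_imp_deriv)
  have "((\<lambda>z. (deriv p z / of_real M) * e z) has_field_derivative
      (deriv (deriv p) 0 / of_real M) * e 0 + (deriv p 0 / of_real M) * ((deriv p 0 / of_real M) * e 0)) (at 0)"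
    using M by (auto intro!: derivative_eq_intros p_deriv2 e_deriv simp: field_simps)
  then have "(deriv e has_field_derivative
      (deriv (deriv p) 0 / of_real M) * e 0 + (deriv p 0 / of_real M) * ((deriv p 0 / of_real M) * e 0)) (at 0)"
    by (rule has_field_derivative_transform_within_open[where S="ball 0 1"]) (auto simp: deriv_e)
  then have e2: "deriv (deriv e) 0 =
      (deriv (deriv p) 0 / of_real M) * e 0 + (deriv p 0 / of_real M) * ((deriv p 0 / of_real M) * e 0)"
    by (rule DERIV_imp_deriv)
  define a where "a = deriv p 0 / of_real M"
  define b where "b = deriv (deriv p) 0 / of_real M"
  have e0: "1 / 3 \<le> cmod (e 0)" "0 < cmod (e 0)" using norm_e_inv[of 0] by auto
  have "cmod a * cmod (e 0) \<le> 6"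
    using cauchy[of 1] deriv_e[of 0] by (simp add: a_def norm_mult[symmetric])
  moreover have "cmod a * (1/3) \<le> cmod a * cmod (e 0)" using e0 by (intro mult_left_mono) auto
  ultimately have a: "cmod a \<le> 18" by simp
  have "cmod (b * e 0 + a * (a * e 0)) \<le> 24"
    using cauchy[of 2] e2 by (simp add: a_def b_def numeral_2_eq_2)
  then have "cmod ((b + a * a) * e 0) \<le> 24" by (simp add: algebra_simps)
  then have "cmod (b + a * a) * cmod (e 0) \<le> 24" by (simp add: norm_mult)
  moreover have "cmod (b + a * a) * (1/3) \<le> cmod (b + a * a) * cmod (e 0)"
    using e0 by (intro mult_left_mono) auto
  ultimately have "cmod (b + a * a) \<le> 72" by simp
  moreover have "cmod (a * a) \<le> 18 * 18" unfolding norm_mult using a by (intro mult_mono) auto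
  moreover have "cmod b \<le> cmod (b + a * a) + cmod (a * a)"
    using norm_triangle_ineq4[of "b + a * a" "a * a"] by simp
  ultimately have "cmod b \<le> 396" by simp
  then show ?thesis using M by (simp add: b_def norm_divide field_simps)
qed

section \<open>Integrals over the unit circle\<close>

text \<open>
  Writing \<open>cos \<theta>\<close> as the mean of \<open>cis (- \<theta>)\<close> and \<open>cis
  \<theta>\<close> splits the integral into three: Cauchy's formulas for the value and for the
  derivative at the centre, and Cauchy's theorem, by which the term with \<open>cis \<theta>\<close>
  vanishes. The rotation \<open>t\<close> is absorbed into the function.
\<close>

lemma circle_integral_cauchy:
  fixes p :: "complex \<Rightarrow> complex"
  assumes holo: "p holomorphic_on ball 0 1" and r: "0 < r" "r < 1"
  shows "((\<lambda>\<theta>. p (of_real r * cis (\<theta> + t)) * of_real (cos \<theta> - \<kappa>)) has_integral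
           of_real pi * (of_real r * cis t * deriv p 0 - 2 * of_real \<kappa> * p 0)) {0..2 * pi}"
proof -
  define q where "q = (\<lambda>z. p (z * cis t))"
  have q_holo: "q holomorphic_on ball 0 1"
    unfolding q_def
    by (rule holomorphic_on_compose_gen[OF _ holo, unfolded o_def])
       (auto intro!: holomorphic_intros simp: norm_mult)
  have "(p has_field_derivative deriv p 0) (at (0 * cis t))" 
    using holo by (auto intro: holomorphic_derivI)
  then have "(q has_field_derivative deriv p 0 * cis t) (at 0)"
    unfolding q_def by (rule DERIV_chain2) (auto intro!: derivative_eq_intros)
  then have deriv_q: "deriv q 0 = deriv p 0 * cis t" by (rule DERIV_imp_deriv)
  have cont: "continuous_on (cball 0 r) q" 
    using q_holo r by (intro holomorphic_on_imp_continuous_on holomorphic_on_subset[OF q_holo]) auto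
  have holr: "q holomorphic_on ball 0 r" using r by (intro holomorphic_on_subset[OF q_holo]) auto
  have *: "((\<lambda>u. q u / (u - 0) ^ Suc k) has_contour_integral
      (2 * pi * \<i>) / fact k * (deriv ^^ k) q 0) (circlepath 0 r)" for k
    by (rule Cauchy_has_contour_integral_higher_derivative_circlepath[OF cont holr]) (use r in auto)
  have angular: "((\<lambda>\<theta>. f (of_real r * cis \<theta>) * (of_real r * cis \<theta>)) has_integral 2 * pi * J) {0..2*pi}"
    if "(f has_contour_integral 2 * pi * \<i> * J) (circlepath 0 r)" for f and J :: complex
  proof -
    have "((\<lambda>\<theta>. f (0 + of_real r * cis \<theta>) * of_real r * \<i> * cis \<theta>) has_integral 2 * pi * \<i> * J) {0..2*pi}"
      using that has_contour_integral_part_circlepath_iff[of 0 "2*pi" f _ 0 r] unfolding circlepath_def by simp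
    from has_integral_divide[OF this, of "\<i>"] show ?thesis by (simp add: mult_ac)
  qed
  have P0: "((\<lambda>\<theta>. q (of_real r * cis \<theta>)) has_integral 2 * pi * q 0) {0..2*pi}"
  proof -
    have "((\<lambda>\<theta>. q (of_real r * cis \<theta>) / (of_real r * cis \<theta>) * (of_real r * cis \<theta>)) has_integral 2 * pi * q 0) {0..2*pi}"
      using *[of 0] by (intro angular) simp
    then show ?thesis using r by simp
  qed
  have P1: "((\<lambda>\<theta>. q (of_real r * cis \<theta>) * cis (-\<theta>)) has_integral 2 * pi * r * deriv q 0) {0..2*pi}"
  proof -
    have "((\<lambda>\<theta>. of_real r * (q (of_real r * cis \<theta>) / (of_real r * cis \<theta>)^2 * (of_real r * cis \<theta>))) has_integral of_real r * (2 * pi * deriv q 0)) {0..2*pi}"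
      using *[of 1] by (intro has_integral_mult_right angular) (simp add: numeral_2_eq_2)
    also have "(\<lambda>\<theta>. of_real r * (q (of_real r * cis \<theta>) / (of_real r * cis \<theta>)^2 * (of_real r * cis \<theta>))) = (\<lambda>\<theta>. q (of_real r * cis \<theta>) * cis (-\<theta>))"
      using r by (simp add: fun_eq_iff power2_eq_square cis_inverse[symmetric] field_simps)
    finally show ?thesis by (simp add: mult_ac)
  qed
  have "(q has_contour_integral 2 * pi * \<i> * 0) (circlepath 0 r)"
  proof -
    have "sphere 0 r \<subseteq> ball (0::complex) 1" using r by auto
    then show ?thesis
      using Cauchy_theorem_disc_simple[of q 0 1 "circlepath 0 r"] q_holo r by simp
  qed
  from has_integral_divide[OF angular[OF this], of "of_real r"]
  have P2: "((\<lambda>\<theta>. q (of_real r * cis \<theta>) * cis \<theta>) has_integral 0) {0..2*pi}"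
    using r by simp
  have cos_cis: "complex_of_real (cos \<theta>) = (cis (-\<theta>) + cis \<theta>) / 2" for \<theta> 
    by (simp add: complex_eq_iff)
  have "((\<lambda>\<theta>. (q (of_real r * cis \<theta>) * cis (-\<theta>) + q (of_real r * cis \<theta>) * cis \<theta>) / 2 - of_real \<kappa> * q (of_real r * cis \<theta>))
     has_integral ((2 * pi * r * deriv q 0 + 0) / 2 - of_real \<kappa> * (2 * pi * q 0))) {0..2*pi}"
    by (intro has_integral_diff has_integral_divide has_integral_add has_integral_mult_right P0 P1 P2)
  moreover have "(2 * pi * r * deriv q 0 + 0) / 2 - of_real \<kappa> * (2 * pi * q 0) = of_real pi * (of_real r * cis t * deriv p 0 - 2 * of_real \<kappa> * p 0)"
  proof -
    have "q 0 = p 0" by (simp add: q_def)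
    then show ?thesis by (simp add: deriv_q algebra_simps)
  qed
  moreover have "(q (of_real r * cis \<theta>) * cis (-\<theta>) + q (of_real r * cis \<theta>) * cis \<theta>) / 2 - of_real \<kappa> * q (of_real r * cis \<theta>)
     = p (of_real r * cis (\<theta> + t)) * of_real (cos \<theta> - \<kappa>)" for \<theta>
  proof -
    have "q (of_real r * cis \<theta>) = p (of_real r * cis (\<theta> + t))"
      unfolding q_def by (simp add: cis_mult[symmetric] mult_ac)
    then show ?thesis by (simp add: cos_cis field_simps)
  qed
  ultimately show ?thesis by (simp only:)
qed

text \<open>
  The kernel \<open>cos \<theta> - \<kappa>\<close> sees only the value at the centre, which is
  zero, and the gradient there. No regularity of the holomorphic function at the boundary is
  available, so the identity is taken on circles of radius \<open>r < 1\<close> and continued to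
  \<open>r = 1\<close> by continuity of the real part alone.
\<close>

lemma boundary_integral_gradient:
  fixes p :: "complex \<Rightarrow> complex" and h :: "complex \<Rightarrow> real"
  assumes holo: "p holomorphic_on ball 0 1" and cont: "continuous_on (cball 0 1) h"
    and h: "\<And>z. z \<in> ball 0 1 \<Longrightarrow> h z = Re (p z)" and h0: "h 0 = 0"
  shows "((\<lambda>\<theta>. h (cis (\<theta> + t)) * (cos \<theta> - \<kappa>)) has_integral pi * Re (cis t * deriv p 0)) {0..2 * pi}"
proof -
  define H where "H = (\<lambda>r. integral {0..2*pi} (\<lambda>\<theta>. h (of_real r * cis (\<theta> + t)) * (cos \<theta> - \<kappa>)))"
  have cont2: "continuous_on ({0..1} \<times> cbox 0 (2*pi)) (\<lambda>(r, \<theta>). h (of_real r * cis (\<theta> + t)) * (cos \<theta> - \<kappa>))"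
    unfolding case_prod_unfold
    by (intro continuous_intros continuous_on_compose2[OF cont])
       (auto simp: norm_mult)
  have contH: "continuous_on {0..1} H"
    using integral_continuous_on_param[OF cont2] unfolding H_def by (simp add: cbox_interval)
  have Hr: "H r = pi * r * Re (cis t * deriv p 0)" if "0 < r" "r < 1" for r
  proof -
    have "((\<lambda>\<theta>. Re (p (of_real r * cis (\<theta> + t)) * of_real (cos \<theta> - \<kappa>))) has_integral
           Re (of_real pi * (of_real r * cis t * deriv p 0 - 2 * of_real \<kappa> * p 0))) {0..2 * pi}"
      by (rule has_integral_linear[OF circle_integral_cauchy[OF holo that] bounded_linear_Re, unfolded o_def])
    moreover have "Re (p (of_real r * cis (\<theta> + t)) * of_real (cos \<theta> - \<kappa>)) = h (of_real r * cis (\<theta> + t)) * (cos \<theta> - \<kappa>)" for \<theta>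
      using that by (subst h) (auto simp: norm_mult)
    moreover have "Re (of_real pi * (of_real r * cis t * deriv p 0 - 2 * of_real \<kappa> * p 0)) = pi * r * Re (cis t * deriv p 0)"
      using h[of 0] h0 by (simp add: algebra_simps)
    ultimately show ?thesis unfolding H_def by (intro integral_unique) (simp only:)
  qed
  have "((\<lambda>r. H r) \<longlongrightarrow> H 1) (at 1 within {0..1})"
    using contH by (auto simp: continuous_on_def)
  then have "(H \<longlongrightarrow> H 1) (at_left 1)"
    by (rule tendsto_mono[rotated]) (auto simp: at_within_Icc_at_left)
  moreover have "((\<lambda>r. pi * r * Re (cis t * deriv p 0)) \<longlongrightarrow> pi * 1 * Re (cis t * deriv p 0)) (at_left 1)"
    by (intro tendsto_intros)
  moreover have "eventually (\<lambda>r. H r = pi * r * Re (cis t * deriv p 0)) (at_left 1)"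
    by (rule eventually_mono[OF eventually_at_left_real[of 0 1]]) (use Hr in auto)
  ultimately have "H 1 = pi * Re (cis t * deriv p 0)"
    using tendsto_unique[of "at_left (1::real)" H "H 1" "pi * 1 * Re (cis t * deriv p 0)"]
    by (simp add: tendsto_cong)
  moreover have "(\<lambda>\<theta>. h (cis (\<theta> + t)) * (cos \<theta> - \<kappa>)) integrable_on {0..2*pi}"
    by (intro integrable_continuous_interval continuous_intros continuous_on_compose2[OF cont]) auto
  ultimately show ?thesis unfolding H_def by (simp add: has_integral_integrable_integral)
qed

lemma sin_le_sin_between:
  fixes u v :: real
  assumes "0 \<le> v" "v \<le> u" "u \<le> pi - v"
  shows "sin v \<le> sin u"
proof (cases "u \<le> pi / 2")
  case True
  then show ?thesis using assms by (intro sin_monotone_2pi_le) auto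
next
  case False
  have "sin v \<le> sin (pi - u)" using False assms by (intro sin_monotone_2pi_le) auto
  then show ?thesis by simp
qed

text \<open>
  On a half period \<open>cos x - cos y\<close> is a product of two sines, and the one at the mean
  of \<open>x\<close> and \<open>y\<close> is in modulus at least the one at half the distance.
\<close>

lemma cos_separation:
  fixes x y :: real
  assumes "x \<le> y" and "0 \<le> x \<and> y \<le> pi \<or> pi \<le> x \<and> y \<le> 2 * pi"
  shows "2 * (sin ((y - x) / 2))\<^sup>2 \<le> \<bar>cos x - cos y\<bar>"
proof -
  let ?v = "(y - x) / 2"
  have s: "0 \<le> sin ?v" using assms by (intro sin_ge_zero) auto
  have "sin ?v \<le> \<bar>sin ((x + y) / 2)\<bar>"
    using assms(2)
  proof
    assume "0 \<le> x \<and> y \<le> pi"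
    then have "sin ?v \<le> sin ((x + y) / 2)"
      using assms(1) by (intro sin_le_sin_between) (auto simp: field_simps)
    then show ?thesis by linarith
  next
    assume "pi \<le> x \<and> y \<le> 2 * pi"
    then have "sin ?v \<le> sin ((x + y) / 2 - pi)"
      using assms(1) by (intro sin_le_sin_between) (auto simp: field_simps)
    then show ?thesis by (simp add: sin_diff)
  qed
  then have "sin ?v * sin ?v \<le> \<bar>sin ((x + y) / 2)\<bar> * sin ?v" using s by (intro mult_right_mono) auto
  then show ?thesis using s by (simp add: cos_diff_cos abs_mult power2_eq_square)
qed

text \<open>
  The cosine can stay within \<open>1/4\<close> of the level \<open>\<kappa>\<close> only on a set
  of diameter at most \<open>pi/3\<close> in each half period. On that set \<open>g\<close> is
  bounded by \<open>R\<close>, and elsewhere the factor \<open>\<bar>cos x - \<kappa>\<bar>\<close>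
  is at least \<open>1/4\<close>. So a function of large integral cannot have a small integral
  against this weight.
\<close>

lemma integral_bound_off_level_set:
  fixes g :: "real \<Rightarrow> real"
  assumes cont: "continuous_on {a..a + pi} g" and g: "\<And>x. x \<in> {a..a + pi} \<Longrightarrow> 0 \<le> g x \<and> g x \<le> R"
    and R: "0 \<le> R" and a: "a = 0 \<or> a = pi"
  shows "integral {a..a + pi} g \<le> 4 * integral {a..a + pi} (\<lambda>x. g x * \<bar>cos x - \<kappa>\<bar>) + R * (pi / 3)"
proof -
  let ?I = "{a..a + pi}"
  define B where "B = {x \<in> ?I. \<bar>cos x - \<kappa>\<bar> < 1/4}"
  have close: "y - x \<le> pi / 3" if "x \<in> B" "y \<in> B" "x \<le> y" for x y
  proof (rule ccontr)
    assume "\<not> y - x \<le> pi / 3"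
    then have "sin (pi / 6) < sin ((y - x) / 2)"
      using that a by (intro sin_monotone_2pi) (auto simp: B_def)
    then have "1/2 < sin ((y - x) / 2)" by (simp add: sin_30)
    then have "(1/2)\<^sup>2 < (sin ((y - x) / 2))\<^sup>2" by (intro power_strict_mono) auto
    moreover have "2 * (sin ((y - x) / 2))\<^sup>2 \<le> \<bar>cos x - cos y\<bar>"
      using that a by (intro cos_separation) (auto simp: B_def)
    moreover have "\<bar>cos x - \<kappa>\<bar> < 1/4" "\<bar>cos y - \<kappa>\<bar> < 1/4" using that by (auto simp: B_def)
    then have "\<bar>cos x - cos y\<bar> < 1/2" by linarith
    ultimately show False by (simp add: power2_eq_square)
  qed
  \<comment> \<open>An interval that contains the bad set replaces it: its indicator has a known integral.\<close>
  obtain c d where cd: "a \<le> c" "c \<le> d" "d \<le> a + pi" "d - c \<le> pi / 3" "B \<subseteq> {c..d}"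
  proof (cases "B = {}")
    case True
    show ?thesis by (rule that[of a a]) (use True in auto)
  next
    case False
    have bb: "bdd_below B" "bdd_above B" unfolding B_def bdd_below_def bdd_above_def by auto
    have sub: "B \<subseteq> ?I" by (auto simp: B_def)
    have "Sup B \<le> Inf B + pi / 3"
    proof (rule cSup_least[OF False])
      fix y assume y: "y \<in> B"
      have "y - pi / 3 \<le> Inf B"
      proof (rule cInf_greatest[OF False])
        fix x assume "x \<in> B"
        then show "y - pi / 3 \<le> x" using close[of x y] y pi_gt_zero by (cases "x \<le> y") (linarith, linarith)
      qed
      then show "y \<le> Inf B + pi / 3" by simp
    qed
    moreover have "a \<le> Inf B" using sub by (intro cInf_greatest[OF False]) auto
    moreover have "Sup B \<le> a + pi" using sub by (intro cSup_least[OF False]) auto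
    moreover have "Inf B \<le> Sup B" using False bb by (meson cInf_le_cSup)
    moreover have "B \<subseteq> {Inf B..Sup B}" using bb by (auto intro: cInf_lower cSup_upper)
    ultimately show ?thesis using that[of "Inf B" "Sup B"] by auto
  qed
  have ind: "((\<lambda>x. if x \<in> {c..d} then R else 0) has_integral R * (d - c)) ?I"
    using cd has_integral_const_real[of R c d]
    by (subst has_integral_restrict) (auto simp: mult.commute)
  have int_g: "g integrable_on ?I" using cont by (rule integrable_continuous_interval)
  have "(\<lambda>x. g x * \<bar>cos x - \<kappa>\<bar>) integrable_on ?I"
    using cont by (intro integrable_continuous_interval continuous_intros)
  then have int_k: "((\<lambda>x. 4 * (g x * \<bar>cos x - \<kappa>\<bar>)) has_integral 4 * integral ?I (\<lambda>x. g x * \<bar>cos x - \<kappa>\<bar>)) ?I"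
    by (intro has_integral_mult_right integrable_integral)
  have "integral ?I g \<le> 4 * integral ?I (\<lambda>x. g x * \<bar>cos x - \<kappa>\<bar>) + R * (d - c)"
  proof (rule has_integral_le[OF integrable_integral[OF int_g] has_integral_add[OF int_k ind]])
    fix x assume x: "x \<in> ?I"
    show "g x \<le> 4 * (g x * \<bar>cos x - \<kappa>\<bar>) + (if x \<in> {c..d} then R else 0)"
    proof (cases "x \<in> {c..d}")
      case True
      have "0 \<le> g x * \<bar>cos x - \<kappa>\<bar>" using g[OF x] by (intro mult_nonneg_nonneg) auto
      then show ?thesis unfolding if_P[OF True] using g[OF x] by linarith
    next
      case False
      then have "1/4 \<le> \<bar>cos x - \<kappa>\<bar>" using cd(5) x by (auto simp: B_def not_less)
      then have "g x * (1/4) \<le> g x * \<bar>cos x - \<kappa>\<bar>" using g[OF x] by (intro mult_left_mono) auto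
      then show ?thesis using False by auto
    qed
  qed
  moreover have "R * (d - c) \<le> R * (pi / 3)" using R cd by (intro mult_left_mono)
  ultimately show ?thesis by linarith
qed

lemma integral_periodic_shift:
  fixes g :: "real \<Rightarrow> real"
  assumes cont: "continuous_on UNIV g" and per: "\<And>x. g (x + T) = g x" and T: "0 \<le> T"
  shows "integral {0..T} (\<lambda>x. g (x + t)) = integral {0..T} g"
proof -
  define G where "G = (\<lambda>t. integral {0..T} (\<lambda>x. g (x + t)))"
  have int: "g integrable_on {a..b}" for a b
    using cont by (intro integrable_continuous_interval) (auto intro: continuous_on_subset)
  have shift: "integral {0..T} (\<lambda>x. g (x + t)) = integral {t..T + t} g" for t
    using integral_shift_Icc_real[of 0 T g t] by (simp add: o_def add.commute)
  have nonneg: "G t = G 0" if t: "0 \<le> t" for t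
  proof -
    have "integral {0..t} g = integral {T..t + T} g"
      using integral_shift_Icc_real[of 0 t g T] per by (simp add: o_def add.commute)
    moreover have "integral {0..t} g + integral {t..T + t} g = integral {0..T + t} g"
      using t T int by (intro Henstock_Kurzweil_Integration.integral_combine) auto
    moreover have "integral {0..T} g + integral {T..T + t} g = integral {0..T + t} g"
      using t T int by (intro Henstock_Kurzweil_Integration.integral_combine) auto
    ultimately show ?thesis unfolding G_def shift by (simp add: add.commute)
  qed
  have step: "G (t + of_nat k * T) = G t" for k t
  proof (induction k)
    case (Suc k)
    have "g (x + (t + of_nat (Suc k) * T)) = g (x + (t + of_nat k * T))" for x
      using per[of "x + (t + of_nat k * T)"] by (simp add: algebra_simps)
    then show ?case using Suc unfolding G_def by simp
  qed simp
  have "G t = G 0"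
  proof (cases "T = 0")
    case True then show ?thesis by (simp add: G_def)
  next
    case False
    then obtain k :: nat where "- t < of_nat k * T" using T reals_Archimedean3[of T] by fastforce
    then show ?thesis using step[of t k] nonneg[of "t + of_nat k * T"] by simp
  qed
  then show ?thesis by (simp add: G_def)
qed

section \<open>Boundary behaviour of homeomorphisms of discs\<close>

lemma connected_half_circle:
  assumes "0 < R"
  shows "connected {w. cmod w = R \<and> 0 < Re w}"
proof -
  have "{w. cmod w = R \<and> 0 < Re w} = (\<lambda>t. of_real R * cis t) ` {- (pi / 2)<..<pi / 2}"
  proof (intro equalityI subsetI)
    fix w assume w: "w \<in> {w. cmod w = R \<and> 0 < Re w}"
    then have "w = of_real R * cis (Arg w)"
      using Arg_eq[of w] assms by (auto simp: cis_conv_exp)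
    moreover have "\<bar>Arg w\<bar> < pi / 2" using w Arg_Re_pos[of w] by blast
    ultimately show "w \<in> (\<lambda>t. of_real R * cis t) ` {- (pi / 2)<..<pi / 2}"
      by (intro image_eqI[of _ _ "Arg w"]) auto
  next
    fix w assume "w \<in> (\<lambda>t. of_real R * cis t) ` {- (pi / 2)<..<pi / 2}"
    then show "w \<in> {w. cmod w = R \<and> 0 < Re w}"
      using assms cos_gt_zero_pi by (auto simp: norm_mult)
  qed
  then show ?thesis
    by (simp only:) (intro connected_continuous_image continuous_intros connected_Ioo)
qed

lemma nonzero_on_connected_imp_constant_sign:
  fixes L :: "'a::topological_space \<Rightarrow> real"
  assumes "connected U" "continuous_on U L" "\<And>w. w \<in> U \<Longrightarrow> L w \<noteq> 0"
  shows "(\<forall>w\<in>U. 0 < L w) \<or> (\<forall>w\<in>U. L w < 0)"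
proof (rule ccontr)
  assume "\<not> ?thesis"
  then obtain v w where "v \<in> U" "L v < 0" "w \<in> U" "0 < L w"
    using assms(3) by (metis linorder_neqE_linordered_idom)
  moreover have "connected (L ` U)" using assms(1,2) by (rule connected_continuous_image[rotated])
  ultimately have "{L v..L w} \<subseteq> L ` U" by (intro connected_contains_Icc) auto
  then have "0 \<in> L ` U" using \<open>L v < 0\<close> \<open>0 < L w\<close> by auto
  then show False using assms(3) by auto
qed

text \<open>
  Invariance of domain: the image of the open disc is open, hence contained in the interior of the
  closed disc.
\<close>

lemma disc_homeomorphism_interior:
  fixes f :: "'a::euclidean_space \<Rightarrow> 'a"
  assumes f: "homeomorphism (cball 0 r) (cball 0 s) f g" and r: "0 < r"
  shows "f ` ball 0 r \<subseteq> ball 0 s"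
proof -
  have inj: "inj_on f (cball 0 r)" 
    by (rule inj_on_inverseI[where g=g]) (use f in \<open>auto simp: homeomorphism_def\<close>)
  have "open (f ` ball 0 r)"
    using f by (intro invariance_of_domain_ball[OF _ r inj]) (auto simp: homeomorphism_def)
  moreover have "f ` ball 0 r \<subseteq> cball 0 s" using homeomorphism_image1[OF f] by auto
  ultimately show ?thesis using interior_maximal[of "f ` ball 0 r" "cball 0 s"] by (simp add: interior_cball)
qed

lemma disc_homeomorphism_boundary:
  fixes f :: "'a::euclidean_space \<Rightarrow> 'a"
  assumes f: "homeomorphism (cball 0 r) (cball 0 s) f g" and s: "0 < s" and z: "norm z = r"
  shows "norm (f z) = s"
proof -
  have z': "z \<in> cball 0 r" using z by simp
  then have "f z \<in> cball 0 s" using homeomorphism_image1[OF f] by blast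
  moreover have "f z \<notin> ball 0 s"
  proof
    assume "f z \<in> ball 0 s"
    then have "g (f z) \<in> ball 0 r"
      using disc_homeomorphism_interior[OF homeomorphism_symD[OF f] s] by blast
    then show False using z homeomorphism_apply1[OF f z'] by simp
  qed
  ultimately show ?thesis by simp
qed

text \<open>
  A homeomorphism of discs maps the circle homeomorphically onto a circle, on which the real part
  vanishes at two points \<open>P\<close> and \<open>Q\<close> only. The line through
  \<open>P\<close> and \<open>Q\<close> separates the two remaining arcs, so its (suitably oriented)
  equation has the sign of the real part all along the circle. In the polar angle measured from the
  direction normal to this line, the equation reads \<open>cos \<theta> = \<kappa>\<close>.
\<close>

lemma real_part_sign_on_circle:
  fixes \<Phi> :: "complex \<Rightarrow> complex"
  assumes hom: "homeomorphism (cball 0 1) (cball 0 R) \<Phi> G" and R: "0 < R"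
  obtains t \<kappa> where "\<And>\<theta>. 0 \<le> Re (\<Phi> (cis (\<theta> + t))) * (cos \<theta> - \<kappa>)"
proof -
  have inv: "G (\<Phi> z) = z" if "z \<in> cball 0 1" for z using hom that by (auto simp: homeomorphism_def)
  have inv': "\<Phi> (G w) = w" if "w \<in> cball 0 R" for w using hom that by (auto simp: homeomorphism_def)
  have contG: "continuous_on (cball 0 R) G" and imG: "G ` cball 0 R = cball 0 1"
    and im: "\<Phi> ` cball 0 1 = cball 0 R"
    using hom by (auto simp: homeomorphism_def)
  have norm_G: "cmod (G w) = 1" if "cmod w = R" for w
    using homeomorphism_symD[OF hom] _ that by (rule disc_homeomorphism_boundary) simp
  have norm_\<Phi>: "cmod (\<Phi> z) = R" if "cmod z = 1" for z
    using hom R that by (rule disc_homeomorphism_boundary)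
  have polar: "z = cis (Arg z)" if "cmod z = 1" for z
    using that cis_Arg[of z] by (cases "z = 0") (simp_all add: sgn_eq)
  define P Q where "P = G (\<i> * of_real R)" and "Q = G (- \<i> * of_real R)"
  have PQ1: "cmod P = 1" "cmod Q = 1" using norm_G R by (simp_all add: P_def Q_def norm_mult)
  have "\<Phi> P = \<i> * of_real R" "\<Phi> Q = - \<i> * of_real R"
    unfolding P_def Q_def using R by (auto intro!: inv' simp: norm_mult)
  then have PQ: "P \<noteq> Q" using R by auto
  define \<alpha> \<beta> where "\<alpha> = Arg P" and "\<beta> = Arg Q"
  have P: "P = cis \<alpha>" and Q: "Q = cis \<beta>"
    using PQ1 polar unfolding \<alpha>_def \<beta>_def by blast+
  \<comment> \<open>The bisecting angle \<open>t\<close> is the direction normal to the line through \<open>P\<close> and \<open>Q\<close>.\<close>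
  define t \<phi> where "t = (\<alpha> + \<beta>) / 2" and "\<phi> = (\<alpha> - \<beta>) / 2"
  have P': "P = cis (\<phi> + t)" and Q': "Q = cis (- \<phi> + t)"
    unfolding P Q t_def \<phi>_def by (auto intro!: arg_cong[where f=cis] simp: field_simps)
  have P'': "P = cis \<phi> * cis t" and Q'': "Q = cis (- \<phi>) * cis t"
    unfolding P' Q' cis_mult by simp_all
  define \<kappa> where "\<kappa> = cos \<phi>"
  define l where "l = (\<lambda>z. Re (z * cis (- t)) - \<kappa>)"
  have l_cis: "l (cis (\<theta> + t)) = cos \<theta> - \<kappa>" for \<theta>
    unfolding l_def cis_mult by simp
  have \<kappa>: "- 1 < \<kappa>" "\<kappa> < 1"
  proof -
    have "sin \<phi> \<noteq> 0"
    proof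
      assume "sin \<phi> = 0"
      then have "cis \<phi> = cis (- \<phi>)" by (simp add: complex_eq_iff)
      then show False using PQ unfolding P'' Q'' by simp
    qed
    then have "\<bar>cos \<phi>\<bar> \<noteq> 1" using sin_zero_abs_cos_one sin_cos_squared_add[of \<phi>] by (auto simp: abs_if power2_eq_square split: if_splits)
    then have "\<bar>cos \<phi>\<bar> < 1" using abs_cos_le_one[of \<phi>] by linarith
    then show "- 1 < \<kappa>" "\<kappa> < 1" unfolding \<kappa>_def by linarith+
  qed
  have l_zero: "z = P \<or> z = Q" if "cmod z = 1" "l z = 0" for z
  proof -
    define \<theta> where "\<theta> = Arg z - t"
    have z: "z = cis (\<theta> + t)" using polar[OF that(1)] by (simp add: \<theta>_def)
    have c: "cos \<theta> = cos \<phi>" using that(2) l_cis[of \<theta>] z by (simp add: \<kappa>_def)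
    then have "(sin \<theta>)\<^sup>2 = (sin \<phi>)\<^sup>2" by (simp add: sin_squared_eq)
    then have "sin \<theta> = sin \<phi> \<or> sin \<theta> = - sin \<phi>" by (simp add: power2_eq_iff)
    then have "cis \<theta> = cis \<phi> \<or> cis \<theta> = cis (- \<phi>)" using c by (auto simp: complex_eq_iff)
    then show ?thesis unfolding z P'' Q'' cis_mult[symmetric] by auto
  qed
  have contL: "continuous_on (cball 0 R) (\<lambda>w. l (G w))"
    unfolding l_def by (intro continuous_intros contG)
  have sign: "(\<forall>w\<in>U. 0 < l (G w)) \<or> (\<forall>w\<in>U. l (G w) < 0)"
    if U: "connected U" "\<And>w. w \<in> U \<Longrightarrow> cmod w = R \<and> Re w \<noteq> 0" for U
  proof (rule nonzero_on_connected_imp_constant_sign[OF U(1)])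
    show "continuous_on U (\<lambda>w. l (G w))" using U(2) by (intro continuous_on_subset[OF contL]) auto
    fix w assume w: "w \<in> U"
    show "l (G w) \<noteq> 0"
    proof
      assume "l (G w) = 0"
      then have "G w = P \<or> G w = Q" using l_zero[of "G w"] norm_G U(2)[OF w] by auto
      moreover have "\<Phi> (G w) = w" using U(2)[OF w] by (intro inv') auto
      ultimately have "Re w = 0" using \<open>\<Phi> P = _\<close> \<open>\<Phi> Q = _\<close> by auto
      then show False using U(2)[OF w] by auto
    qed
  qed
  let ?U = "{w. cmod w = R \<and> 0 < Re w}"
  have eqV: "{w. cmod w = R \<and> Re w < 0} = uminus ` ?U"
    by (auto intro!: image_eqI[of _ _ "- _"])
  have V: "connected {w. cmod w = R \<and> Re w < 0}"
    unfolding eqV by (intro connected_continuous_image continuous_intros connected_half_circle R)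
  have sU: "(\<forall>w\<in>?U. 0 < l (G w)) \<or> (\<forall>w\<in>?U. l (G w) < 0)"
    by (rule sign[OF connected_half_circle[OF R]]) auto
  have sV: "(\<forall>w\<in>{w. cmod w = R \<and> Re w < 0}. 0 < l (G w)) \<or> (\<forall>w\<in>{w. cmod w = R \<and> Re w < 0}. l (G w) < 0)"
    by (rule sign[OF V]) auto
  have trans: "l z = l (G (\<Phi> z))" "cmod (\<Phi> z) = R" if "cmod z = 1" for z
    using that by (simp_all add: inv norm_\<Phi>)
  have zero: "l z = 0" if "cmod z = 1" "Re (\<Phi> z) = 0" for z
  proof -
    have "\<bar>Im (\<Phi> z)\<bar> = R" using norm_\<Phi>[OF that(1)] that(2) by (simp add: cmod_def)
    then have "\<Phi> z = \<i> * of_real R \<or> \<Phi> z = - \<i> * of_real R" using that(2) by (auto simp: complex_eq_iff abs_if split: if_splits)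
    then have "z = P \<or> z = Q" using inv[of z] that(1) unfolding P_def Q_def by auto
    then show ?thesis using l_cis[of \<phi>] l_cis[of "- \<phi>"] unfolding P' Q' by (auto simp: \<kappa>_def)
  qed
  have l_signs: "0 < l (cis t)" "l (cis (pi + t)) < 0"
    using l_cis[of 0] l_cis[of pi] \<kappa> by simp_all
  have cases: "Re (\<Phi> z) > 0 \<or> Re (\<Phi> z) < 0 \<or> l z = 0" if "cmod z = 1" for z
    using zero[OF that] by linarith
  \<comment> \<open>Equal signs on both arcs are impossible, since \<open>l\<close> takes both signs on the circle.\<close>
  consider (pos) "\<And>z. cmod z = 1 \<Longrightarrow> 0 \<le> Re (\<Phi> z) * l z" | (neg) "\<And>z. cmod z = 1 \<Longrightarrow> 0 \<le> - (Re (\<Phi> z) * l z)"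
  proof -
    have one: "cmod (cis t) = 1" "cmod (cis (pi + t)) = 1" by simp_all
    from sU sV show ?thesis
    proof (elim disjE, goal_cases)
      case 1
      then have "0 \<le> l (cis (pi + t))" using cases[OF one(2)] trans[OF one(2)] by force
      then show ?case using l_signs by simp
    next
      case 2
      have "0 \<le> Re (\<Phi> z) * l z" if z: "cmod z = 1" for z
        using cases[OF z] trans[OF z] 2 by (auto simp: zero_le_mult_iff less_imp_le)
      then show ?case by (rule pos)
    next
      case 3
      have "0 \<le> - (Re (\<Phi> z) * l z)" if z: "cmod z = 1" for z
        using cases[OF z] trans[OF z] 3 by (auto simp: mult_le_0_iff less_imp_le)
      then show ?case by (rule neg)
    next
      case 4
      then have "l (cis t) \<le> 0" using cases[OF one(1)] trans[OF one(1)] by force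
      then show ?case using l_signs by simp
    qed
  qed
  then show ?thesis
  proof cases
    case pos
    show ?thesis by (rule that[of t \<kappa>]) (use pos l_cis in \<open>metis norm_cis\<close>)
  next
    case neg
    \<comment> \<open>Turning the direction by \<open>pi\<close> changes the sign of the equation of the line.\<close>
    show ?thesis
    proof (rule that[of "pi + t" "- \<kappa>"])
      fix \<theta>
      show "0 \<le> Re (\<Phi> (cis (\<theta> + (pi + t)))) * (cos \<theta> - - \<kappa>)"
      proof -
        have "cos \<theta> - - \<kappa> = - l (cis (\<theta> + (pi + t)))"
          using l_cis[of "\<theta> + pi"] by (simp add: add.assoc)
        then show ?thesis using neg[of "cis (\<theta> + (pi + t))"] by simp
      qed
    qed
  qed
qed

section \<open>Heinz's lemma\<close>

text \<open>
  If the boundary values of a harmonic function have the sign of \<open>cos \<theta> -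
  \<kappa>\<close>, then nothing cancels in the integral that represents its gradient at the centre.
  This integral is then that of \<open>\<bar>h\<bar> \<bar>cos \<theta> - \<kappa>\<bar>\<close>,
  which is large as soon as \<open>\<bar>h\<bar>\<close> is bounded by \<open>R\<close> and has
  enough mass on the circle.
\<close>

lemma gradient_lower_bound_of_boundary_mass:
  fixes p :: "complex \<Rightarrow> complex" and h :: "complex \<Rightarrow> real"
  assumes holo: "p holomorphic_on ball 0 1" and cont: "continuous_on (cball 0 1) h"
    and h: "\<And>z. z \<in> ball 0 1 \<Longrightarrow> h z = Re (p z)" and h0: "h 0 = 0"
    and sign: "\<And>\<theta>. 0 \<le> h (cis (\<theta> + t)) * (cos \<theta> - \<kappa>)"
    and bound: "\<And>z. cmod z = 1 \<Longrightarrow> \<bar>h z\<bar> \<le> R"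
    and mass: "pi * R \<le> integral {0..2 * pi} (\<lambda>\<theta>. \<bar>h (cis \<theta>)\<bar>)"
  shows "R / 12 \<le> cmod (deriv p 0)"
proof -
  have R: "0 \<le> R" using bound[of 1] by simp
  define g where "g = (\<lambda>\<theta>. \<bar>h (cis (\<theta> + t))\<bar>)"
  have contg: "continuous_on A g" for A
    unfolding g_def by (intro continuous_intros continuous_on_compose2[OF cont]) auto
  have contg0: "continuous_on UNIV (\<lambda>\<theta>. \<bar>h (cis \<theta>)\<bar>)"
    by (intro continuous_intros continuous_on_compose2[OF cont]) auto
  have "pi * R \<le> integral {0..2 * pi} g"
    using mass integral_periodic_shift[OF contg0, of "2*pi" t] by (simp add: g_def cis_mult[symmetric])
  also have "\<dots> = integral {0..pi} g + integral {pi..2 * pi} g"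
    using integrable_continuous_interval[OF contg]
    by (intro Henstock_Kurzweil_Integration.integral_combine[symmetric]) auto
  also have "\<dots> \<le> (4 * integral {0..pi} (\<lambda>x. g x * \<bar>cos x - \<kappa>\<bar>) + R * (pi / 3))
      + (4 * integral {pi..2 * pi} (\<lambda>x. g x * \<bar>cos x - \<kappa>\<bar>) + R * (pi / 3))"
    using integral_bound_off_level_set[OF contg, of 0 R \<kappa>] integral_bound_off_level_set[OF contg, of pi R \<kappa>]
      R bound by (intro add_mono) (auto simp: g_def)
  also have "\<dots> = 4 * (integral {0..pi} (\<lambda>x. g x * \<bar>cos x - \<kappa>\<bar>) + integral {pi..2 * pi} (\<lambda>x. g x * \<bar>cos x - \<kappa>\<bar>)) + 2 * R * pi / 3"
    by simp
  also have "integral {0..pi} (\<lambda>x. g x * \<bar>cos x - \<kappa>\<bar>) + integral {pi..2 * pi} (\<lambda>x. g x * \<bar>cos x - \<kappa>\<bar>)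
      = integral {0..2 * pi} (\<lambda>x. g x * \<bar>cos x - \<kappa>\<bar>)"
    by (intro Henstock_Kurzweil_Integration.integral_combine integrable_continuous_interval continuous_intros contg) auto
  also have "(\<lambda>x. g x * \<bar>cos x - \<kappa>\<bar>) = (\<lambda>x. h (cis (x + t)) * (cos x - \<kappa>))"
    using sign unfolding g_def by (simp add: fun_eq_iff abs_mult[symmetric])
  also have "integral {0..2 * pi} \<dots> = pi * Re (cis t * deriv p 0)"
    using boundary_integral_gradient[OF holo cont h h0] by (intro integral_unique) auto
  finally have "pi * R \<le> pi * (4 * Re (cis t * deriv p 0) + 2 * R / 3)" by (simp add: algebra_simps)
  then have "R \<le> 4 * Re (cis t * deriv p 0) + 2 * R / 3" by (simp only: mult_le_cancel_left_pos[OF pi_gt_zero])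
  moreover have "Re (cis t * deriv p 0) \<le> cmod (deriv p 0)"
    using complex_Re_le_cmod[of "cis t * deriv p 0"] by (simp add: norm_mult)
  ultimately show ?thesis by simp
qed

text \<open>
  Heinz's lemma, with a non-optimal constant. On the circle \<open>\<bar>Re \<Phi>\<bar> + \<bar>Im
  \<Phi>\<bar> \<ge> \<bar>\<Phi>\<bar> = R\<close>, so one of the two coordinate functions has mass
  at least \<open>pi R\<close>. The imaginary part is the real part of \<open>- \<i> \<Phi>\<close>,
  to which the sign lemma applies as well.
\<close>

lemma heinz_lower_bound:
  fixes \<Phi> p q :: "complex \<Rightarrow> complex"
  assumes hom: "homeomorphism (cball 0 1) (cball 0 R) \<Phi> G" and R: "0 < R" and \<Phi>0: "\<Phi> 0 = 0"
    and p: "p holomorphic_on ball 0 1" "\<And>z. z \<in> ball 0 1 \<Longrightarrow> Re (\<Phi> z) = Re (p z)"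
    and q: "q holomorphic_on ball 0 1" "\<And>z. z \<in> ball 0 1 \<Longrightarrow> Im (\<Phi> z) = Re (q z)"
  shows "R / 12 \<le> cmod (deriv p 0) \<or> R / 12 \<le> cmod (deriv q 0)"
proof -
  have cont: "continuous_on (cball 0 1) \<Phi>" using hom by (simp add: homeomorphism_def)
  have norm_\<Phi>: "cmod (\<Phi> z) = R" if "cmod z = 1" for z
    using hom R that by (rule disc_homeomorphism_boundary)
  have hom': "homeomorphism (cball 0 1) (cball 0 R) (\<lambda>z. - \<i> * \<Phi> z) (\<lambda>w. G (\<i> * w))"
  proof -
    have "homeomorphism (cball 0 R) (cball 0 R) (\<lambda>w. - \<i> * w) (\<lambda>w. \<i> * w)"
      by (rule homeomorphismI) (auto intro!: continuous_intros simp: norm_mult mult.assoc[symmetric])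
    from homeomorphism_compose[OF hom this] show ?thesis by (simp add: o_def)
  qed
  obtain t1 \<kappa>1 where s1: "\<And>\<theta>. 0 \<le> Re (\<Phi> (cis (\<theta> + t1))) * (cos \<theta> - \<kappa>1)"
    using real_part_sign_on_circle[OF hom R] by blast
  obtain t2 \<kappa>2 where s2: "\<And>\<theta>. 0 \<le> Re (- \<i> * \<Phi> (cis (\<theta> + t2))) * (cos \<theta> - \<kappa>2)"
    using real_part_sign_on_circle[OF hom' R] by blast
  define I1 where "I1 = integral {0..2 * pi} (\<lambda>\<theta>. \<bar>Re (\<Phi> (cis \<theta>))\<bar>)"
  define I2 where "I2 = integral {0..2 * pi} (\<lambda>\<theta>. \<bar>Im (\<Phi> (cis \<theta>))\<bar>)"
  have "((\<lambda>\<theta>. \<bar>Re (\<Phi> (cis \<theta>))\<bar> + \<bar>Im (\<Phi> (cis \<theta>))\<bar>) has_integral I1 + I2) {0..2 * pi}"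
    unfolding I1_def I2_def
    by (intro has_integral_add integrable_integral integrable_continuous_interval continuous_intros
        continuous_on_compose2[OF cont]) auto
  moreover have "((\<lambda>\<theta>::real. R) has_integral 2 * pi * R) {0..2 * pi}"
    using has_integral_const_real[of R 0 "2*pi"] by simp
  moreover have "R \<le> \<bar>Re (\<Phi> (cis \<theta>))\<bar> + \<bar>Im (\<Phi> (cis \<theta>))\<bar>" for \<theta>
    using norm_\<Phi>[of "cis \<theta>"] cmod_le[of "\<Phi> (cis \<theta>)"] by simp
  ultimately have "2 * pi * R \<le> I1 + I2" by (auto intro: has_integral_le)
  then consider "pi * R \<le> I1" | "pi * R \<le> I2" by linarith
  then show ?thesis
  proof cases
    case 1
    have "R / 12 \<le> cmod (deriv p 0)"
    proof (rule gradient_lower_bound_of_boundary_mass[OF p(1) _ p(2) _ s1])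
      show "\<bar>Re (\<Phi> z)\<bar> \<le> R" if "cmod z = 1" for z
        using abs_Re_le_cmod[of "\<Phi> z"] norm_\<Phi>[OF that] by simp
    qed (use cont 1 \<Phi>0 in \<open>auto simp: I1_def intro: continuous_intros\<close>)
    then show ?thesis ..
  next
    case 2
    have "R / 12 \<le> cmod (deriv q 0)"
    proof (rule gradient_lower_bound_of_boundary_mass[OF q(1) _ q(2)])
      show "0 \<le> Im (\<Phi> (cis (\<theta> + t2))) * (cos \<theta> - \<kappa>2)" for \<theta> using s2[of \<theta>] by simp
      show "\<bar>Im (\<Phi> z)\<bar> \<le> R" if "cmod z = 1" for z
        using abs_Im_le_cmod[of "\<Phi> z"] norm_\<Phi>[OF that] by simp
    qed (use cont 2 \<Phi>0 in \<open>auto simp: I2_def intro: continuous_intros\<close>)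
    then show ?thesis ..
  qed
qed

section \<open>Second-order partial derivatives\<close>

abbreviation has_partials :: "(real \<times> real \<Rightarrow> real) \<Rightarrow> real \<Rightarrow> real \<Rightarrow> real \<times> real \<Rightarrow> bool" where
  "has_partials f a b z \<equiv> (f has_derivative (\<lambda>v. fst v * a + snd v * b)) (at z)"

text \<open>
  The first and second partial derivatives of \<open>f\<close> on \<open>U\<close>. One function
  \<open>fxy\<close> serves for both mixed derivatives, so that their equality is part of the
  notion.
\<close>

definition jet2 where
  "jet2 U f fx fy fxx fxy fyy \<longleftrightarrow>
    (\<forall>z\<in>U. has_partials f (fx z) (fy z) z \<and> has_partials fx (fxx z) (fxy z) z
         \<and> has_partials fy (fxy z) (fyy z) z)"

lemma has_partials_unique:
  assumes "has_partials f a b z" "has_partials f c d z"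
  shows "a = c" "b = d"
proof -
  have "(\<lambda>v. fst v * a + snd v * b) = (\<lambda>v. fst v * c + snd v * d)"
    using assms by (rule has_derivative_unique)
  from fun_cong[OF this, of "(1, 0)"] fun_cong[OF this, of "(0, 1)"] show "a = c" "b = d" by simp_all
qed

lemma has_partials_mult:
  assumes "has_partials f a b z" "has_partials g c d z"
  shows "has_partials (\<lambda>w. f w * g w) (a * g z + f z * c) (b * g z + f z * d) z"
  by (rule has_derivative_eq_rhs[OF has_derivative_mult[OF assms]]) (simp add: fun_eq_iff algebra_simps)

lemma has_partials_add:
  assumes "has_partials f a b z" "has_partials g c d z"
  shows "has_partials (\<lambda>w. f w + g w) (a + c) (b + d) z"
  by (rule has_derivative_eq_rhs[OF has_derivative_add[OF assms]]) (simp add: fun_eq_iff algebra_simps)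

lemma has_partials_sum:
  assumes "\<And>i. i \<in> I \<Longrightarrow> has_partials (f i) (a i) (b i) z"
  shows "has_partials (\<lambda>w. \<Sum>i\<in>I. f i w) (\<Sum>i\<in>I. a i) (\<Sum>i\<in>I. b i) z"
  by (rule has_derivative_eq_rhs[OF has_derivative_sum[OF assms]])
     (simp_all add: fun_eq_iff sum.distrib sum_distrib_left)

lemma has_partials_compose:
  assumes "has_partials f a b (u z, v z)" "has_partials u ux uy z" "has_partials v vx vy z"
  shows "has_partials (\<lambda>w. f (u w, v w)) (a * ux + b * vx) (a * uy + b * vy) z"
proof -
  have "((\<lambda>w. (u w, v w)) has_derivative (\<lambda>h. (fst h * ux + snd h * uy, fst h * vx + snd h * vy))) (at z)"
    using assms(2,3) by (rule has_derivative_Pair)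
  from has_derivative_compose[OF this assms(1)] show ?thesis
    by (rule has_derivative_eq_rhs) (simp add: fun_eq_iff algebra_simps)
qed

lemma has_partials_cong:
  assumes "has_partials f a b z" "open U" "z \<in> U" "\<And>w. w \<in> U \<Longrightarrow> f w = g w"
  shows "has_partials g a b z"
  using assms by (rule has_derivative_transform_within_open)

lemma has_partials_iff_pdiff:
  fixes z :: "real \<times> real"
  assumes "z \<in> ball 0 r"
  shows "has_partials f a b z \<longleftrightarrow>
    f differentiable (at z) \<and> pdiff (cball 0 r) 1 f z = a \<and> pdiff (cball 0 r) 2 f z = b"
proof -
  have "z \<in> interior (cball 0 r)" using assms by (simp add: interior_cball)
  then have at: "at z within cball 0 r = at z" by (rule at_within_interior)
  have decomp: "L v = fst v * L (1, 0) + snd v * L (0, 1)" if "linear L" for L :: "real \<times> real \<Rightarrow> real" and v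
  proof -
    have "L v = L (fst v *\<^sub>R (1, 0) + snd v *\<^sub>R (0, 1))" by (simp add: prod_eq_iff)
    also have "\<dots> = fst v * L (1, 0) + snd v * L (0, 1)"
      using that by (simp only: linear_add linear_cmul real_scaleR_def)
    finally show ?thesis .
  qed
  show ?thesis
  proof
    assume f: "has_partials f a b z"
    then have "frechet_derivative f (at z) = (\<lambda>v. fst v * a + snd v * b)"
      by (rule frechet_derivative_at[symmetric])
    then show "f differentiable (at z) \<and> pdiff (cball 0 r) 1 f z = a \<and> pdiff (cball 0 r) 2 f z = b"
      using f unfolding pdiff_def at by (auto simp: differentiable_def)
  next
    assume *: "f differentiable (at z) \<and> pdiff (cball 0 r) 1 f z = a \<and> pdiff (cball 0 r) 2 f z = b"
    then have f: "(f has_derivative frechet_derivative f (at z)) (at z)"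
      by (simp add: frechet_derivative_works)
    have "frechet_derivative f (at z) v = fst v * a + snd v * b" for v
      using decomp[OF has_derivative_linear[OF f], of v] * unfolding pdiff_def at by simp
    then show "has_partials f a b z" using f by (intro has_derivative_eq_rhs[OF f]) (simp add: fun_eq_iff)
  qed
qed

lemma differentiable_on_imp_has_partials:
  fixes z :: "real \<times> real"
  assumes "f differentiable_on cball 0 r" "z \<in> ball 0 r"
  shows "has_partials f (pdiff (cball 0 r) 1 f z) (pdiff (cball 0 r) 2 f z) z"
proof -
  have "z \<in> interior (cball 0 r)" using assms by (simp add: interior_cball)
  then have "at z within cball 0 r = at z" by (rule at_within_interior)
  moreover have "f differentiable (at z within cball 0 r)" using assms by (simp add: differentiable_on_def)
  ultimately have "f differentiable (at z)" by simp
  then show ?thesis using has_partials_iff_pdiff[OF assms(2)] by blast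
qed

text \<open>
  Young's argument: the mean value theorem in the first variable turns the second difference into
  \<open>s\<close> times an increment of \<open>hx\<close>, which differentiability of
  \<open>hx\<close> at the one point evaluates up to \<open>o(s)\<close>.
\<close>

lemma second_difference_limit:
  fixes h hx :: "real \<times> real \<Rightarrow> real"
  assumes e: "0 < e"
    and hx: "\<And>x y. (x, y) \<in> ball (x0, y0) e \<Longrightarrow> ((\<lambda>t. h (t, y)) has_real_derivative hx (x, y)) (at x)"
    and A: "has_partials hx A B (x0, y0)"
  shows "((\<lambda>s. (h (x0 + s, y0 + s) - h (x0 + s, y0) - h (x0, y0 + s) + h (x0, y0)) / s\<^sup>2) \<longlongrightarrow> B) (at_right 0)"
proof (rule tendstoI)
  fix \<epsilon> :: real assume \<epsilon>: "0 < \<epsilon>"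
  then have "0 < \<epsilon> / 5" by simp
  then obtain d where d: "0 < d" and
    approx: "\<And>w. norm (w - (x0, y0)) < d \<Longrightarrow>
      norm (hx w - hx (x0, y0) - (fst (w - (x0, y0)) * A + snd (w - (x0, y0)) * B)) \<le> \<epsilon> / 5 * norm (w - (x0, y0))"
    using A unfolding has_derivative_at_alt by blast
  define m where "m = min d e / 2"
  have m: "0 < m" using d e by (simp add: m_def)
  have small: "norm (a, b) \<le> 2 * s" "norm (a, b) < d" "norm (a, b) < e"
    if "\<bar>a\<bar> \<le> s" "\<bar>b\<bar> \<le> s" "s < m" for a b s :: real
    using norm_Pair_le[of a b] that by (auto simp: m_def)
  have "dist ((h (x0 + s, y0 + s) - h (x0 + s, y0) - h (x0, y0 + s) + h (x0, y0)) / s\<^sup>2) B < \<epsilon>"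
    if s: "0 < s" "s < m" for s
  proof -
    have in_ball: "(x, y) \<in> ball (x0, y0) e" if "x0 \<le> x" "x \<le> x0 + s" "y0 \<le> y" "y \<le> y0 + s" for x y
      using small(3)[of "x0 - x" s "y0 - y"] that s by (simp add: dist_norm)
    have "\<exists>\<xi>. x0 < \<xi> \<and> \<xi> < x0 + s \<and>
        (h (x0 + s, y0 + s) - h (x0 + s, y0)) - (h (x0, y0 + s) - h (x0, y0))
          = (x0 + s - x0) * (hx (\<xi>, y0 + s) - hx (\<xi>, y0))"
      by (rule MVT2[where f="\<lambda>t. h (t, y0 + s) - h (t, y0)"])
         (use s in \<open>auto intro!: DERIV_diff hx in_ball\<close>)
    then obtain \<xi> where \<xi>: "x0 < \<xi>" "\<xi> < x0 + s" and
      mvt: "h (x0 + s, y0 + s) - h (x0 + s, y0) - h (x0, y0 + s) + h (x0, y0) = s * (hx (\<xi>, y0 + s) - hx (\<xi>, y0))"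
      by (auto simp: algebra_simps)
    have est: "\<bar>hx (\<xi>, y0 + b) - hx (x0, y0) - ((\<xi> - x0) * A + b * B)\<bar> \<le> \<epsilon> / 5 * (2 * s)" if "\<bar>b\<bar> \<le> s" for b
    proof -
      have small': "norm (\<xi> - x0, b) < d" "norm (\<xi> - x0, b) \<le> 2 * s"
        using small[of "\<xi> - x0" s b] \<xi> s that by auto
      then have "\<bar>hx (\<xi>, y0 + b) - hx (x0, y0) - ((\<xi> - x0) * A + b * B)\<bar> \<le> \<epsilon> / 5 * norm (\<xi> - x0, b)"
        using approx[of "(\<xi>, y0 + b)"] by simp
      also have "\<dots> \<le> \<epsilon> / 5 * (2 * s)" using small'(2) \<epsilon> by (intro mult_left_mono) auto
      finally show ?thesis .
    qed
    have "\<bar>hx (\<xi>, y0 + s) - hx (\<xi>, y0) - s * B\<bar> \<le> \<epsilon> / 5 * (4 * s)"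
    proof -
      have "\<bar>hx (\<xi>, y0 + s) - hx (x0, y0) - ((\<xi> - x0) * A + s * B)\<bar> \<le> \<epsilon> / 5 * (2 * s)"
          "\<bar>hx (\<xi>, y0) - hx (x0, y0) - (\<xi> - x0) * A\<bar> \<le> \<epsilon> / 5 * (2 * s)"
        using est[of s] est[of 0] s by simp_all
      then show ?thesis by argo
    qed
    also have "\<dots> < \<epsilon> * s" using \<epsilon> s by simp
    finally have "\<bar>(hx (\<xi>, y0 + s) - hx (\<xi>, y0)) / s - B\<bar> < \<epsilon>"
      using s by (simp add: field_simps abs_if split: if_splits)
    moreover have "(h (x0 + s, y0 + s) - h (x0 + s, y0) - h (x0, y0 + s) + h (x0, y0)) / s\<^sup>2
        = (hx (\<xi>, y0 + s) - hx (\<xi>, y0)) / s"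
      using s unfolding mvt by (simp add: power2_eq_square)
    ultimately show ?thesis by (simp add: dist_real_def)
  qed
  then show "eventually (\<lambda>s. dist ((h (x0 + s, y0 + s) - h (x0 + s, y0) - h (x0, y0 + s) + h (x0, y0)) / s\<^sup>2) B < \<epsilon>) (at_right 0)"
    using eventually_at_right_real[OF m] by (rule eventually_mono[rotated]) auto
qed

lemma has_partials_imp_DERIV:
  assumes "has_partials f a b (x, y)"
  shows "((\<lambda>t. f (t, y)) has_real_derivative a) (at x)" "((\<lambda>t. f (x, t)) has_real_derivative b) (at y)"
proof -
  have "((\<lambda>t. (t, y)) has_derivative (\<lambda>h. (h, 0))) (at x)" "((\<lambda>t. (x, t)) has_derivative (\<lambda>h. (0, h))) (at y)"
    by (auto intro!: derivative_eq_intros)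
  from has_derivative_compose[OF this(1) assms] has_derivative_compose[OF this(2) assms]
  show "((\<lambda>t. f (t, y)) has_real_derivative a) (at x)" "((\<lambda>t. f (x, t)) has_real_derivative b) (at y)"
    unfolding has_field_derivative_def by (auto elim!: has_derivative_eq_rhs)
qed

text \<open>
  The second difference is symmetric in the two variables, so the limit of its quotient by
  \<open>s\<^sup>2\<close> is either mixed derivative.
\<close>

lemma mixed_partials_eq:
  fixes h hx hy :: "real \<times> real \<Rightarrow> real"
  assumes U: "open U" "z \<in> U" and h: "\<And>w. w \<in> U \<Longrightarrow> has_partials h (hx w) (hy w) w"
    and hx: "has_partials hx a b z" and hy: "has_partials hy c d z"
  shows "b = c"
proof -
  obtain x0 y0 where z: "z = (x0, y0)" by (cases z)
  obtain e where e: "0 < e" "ball (x0, y0) e \<subseteq> U" using U openE unfolding z by blast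
  have "((\<lambda>s. (h (x0 + s, y0 + s) - h (x0 + s, y0) - h (x0, y0 + s) + h (x0, y0)) / s\<^sup>2) \<longlongrightarrow> b) (at_right 0)"
    using e hx has_partials_imp_DERIV(1)[OF h] unfolding z
    by (intro second_difference_limit[where hx=hx]) auto
  moreover have "((\<lambda>s. ((\<lambda>(y, x). h (x, y)) (y0 + s, x0 + s) - (\<lambda>(y, x). h (x, y)) (y0 + s, x0)
      - (\<lambda>(y, x). h (x, y)) (y0, x0 + s) + (\<lambda>(y, x). h (x, y)) (y0, x0)) / s\<^sup>2) \<longlongrightarrow> c) (at_right 0)"
  proof (rule second_difference_limit[OF e(1)])
    fix y x assume "(y, x) \<in> ball (y0, x0) e"
    then have "(x, y) \<in> U" using e(2) by (auto simp: dist_Pair_Pair add.commute)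
    then show "((\<lambda>t. (\<lambda>(y, x). h (x, y)) (t, x)) has_real_derivative (\<lambda>w. hy (snd w, fst w)) (y, x)) (at y)"
      using has_partials_imp_DERIV(2)[OF h] by simp
  next
    have "has_partials hy c d (snd (y0, x0), fst (y0, x0))" using hy z by simp
    moreover have "has_partials snd 0 1 (y0, x0)" "has_partials fst 1 0 (y0, x0)"
      by (auto intro!: derivative_eq_intros)
    ultimately have "has_partials (\<lambda>w. hy (snd w, fst w)) (c * 0 + d * 1) (c * 1 + d * 0) (y0, x0)"
      by (rule has_partials_compose)
    then show "has_partials (\<lambda>w. hy (snd w, fst w)) d c (y0, x0)" by simp
  qed
  ultimately show ?thesis
    by (intro tendsto_unique[of "at_right (0::real)"]) (auto simp: algebra_simps)
qed

text \<open>
  On the open disc any second-order jet must consist of the derivatives taken relative to the closed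
  disc; these are the ones that occur in the geometric quantities.
\<close>

lemma jet2_pdiff:
  assumes "jet2 (ball 0 r) f fx fy fxx fxy fyy"
  defines "S \<equiv> cball 0 r"
  shows "jet2 (ball 0 r) f (pdiff S 1 f) (pdiff S 2 f) (pdiff S 1 (pdiff S 1 f)) (pdiff S 2 (pdiff S 1 f)) (pdiff S 2 (pdiff S 2 f))"
    and "z \<in> ball 0 r \<Longrightarrow> pdiff S 1 f z = fx z" "z \<in> ball 0 r \<Longrightarrow> pdiff S 2 f z = fy z"
    and "z \<in> ball 0 r \<Longrightarrow> pdiff S 1 (pdiff S 1 f) z = fxx z" "z \<in> ball 0 r \<Longrightarrow> pdiff S 2 (pdiff S 1 f) z = fxy z"
    and "z \<in> ball 0 r \<Longrightarrow> pdiff S 2 (pdiff S 2 f) z = fyy z"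
proof -
  have f: "has_partials f (fx z) (fy z) z" "has_partials fx (fxx z) (fxy z) z" "has_partials fy (fxy z) (fyy z) z"
    if "z \<in> ball 0 r" for z using assms(1) that unfolding jet2_def by auto
  have 1: "pdiff S 1 f z = fx z" "pdiff S 2 f z = fy z" if "z \<in> ball 0 r" for z
    using f(1)[OF that] that unfolding S_def has_partials_iff_pdiff[OF that] by auto
  have 2: "has_partials (pdiff S 1 f) (fxx z) (fxy z) z" "has_partials (pdiff S 2 f) (fxy z) (fyy z) z"
    if "z \<in> ball 0 r" for z
    using has_partials_cong[OF f(2)[OF that] open_ball that] has_partials_cong[OF f(3)[OF that] open_ball that] 1
    by auto
  have 3: "pdiff S 1 (pdiff S 1 f) z = fxx z" "pdiff S 2 (pdiff S 1 f) z = fxy z"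
      "pdiff S 2 (pdiff S 2 f) z = fyy z" if "z \<in> ball 0 r" for z
    using 2[OF that] unfolding has_partials_iff_pdiff[OF that] S_def[symmetric] by auto
  show "jet2 (ball 0 r) f (pdiff S 1 f) (pdiff S 2 f) (pdiff S 1 (pdiff S 1 f)) (pdiff S 2 (pdiff S 1 f)) (pdiff S 2 (pdiff S 2 f))"
    unfolding jet2_def using f 1 2 3 by auto
  show "z \<in> ball 0 r \<Longrightarrow> pdiff S 1 f z = fx z" "z \<in> ball 0 r \<Longrightarrow> pdiff S 2 f z = fy z"
    "z \<in> ball 0 r \<Longrightarrow> pdiff S 1 (pdiff S 1 f) z = fxx z" "z \<in> ball 0 r \<Longrightarrow> pdiff S 2 (pdiff S 1 f) z = fxy z"
    "z \<in> ball 0 r \<Longrightarrow> pdiff S 2 (pdiff S 2 f) z = fyy z"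
    using 1 3 by auto
qed

lemma Ck_on_imp_jet2:
  assumes "Ck_on 3 (cball 0 r) f"
  obtains fx fy fxx fxy fyy where "jet2 (ball 0 r) f fx fy fxx fxy fyy"
proof -
  let ?S = "cball 0 r :: (real \<times> real) set"
  have diff: "f differentiable_on ?S" "pdiff ?S 1 f differentiable_on ?S" "pdiff ?S 2 f differentiable_on ?S"
    using assms by (simp_all add: numeral_3_eq_3)
  note D = diff[THEN differentiable_on_imp_has_partials]
  have mixed: "pdiff ?S 2 (pdiff ?S 1 f) z = pdiff ?S 1 (pdiff ?S 2 f) z" if "z \<in> ball 0 r" for z
    by (rule mixed_partials_eq[OF open_ball that D(1) D(2)[OF that] D(3)[OF that]])
  have "jet2 (ball 0 r) f (pdiff ?S 1 f) (pdiff ?S 2 f) (pdiff ?S 1 (pdiff ?S 1 f)) (pdiff ?S 2 (pdiff ?S 1 f)) (pdiff ?S 2 (pdiff ?S 2 f))"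
    unfolding jet2_def using D mixed by auto
  then show thesis by (rule that)
qed

lemma jet2_compose:
  assumes f: "jet2 V f fx fy fxx fxy fyy" and u: "jet2 U u ux uy uxx uxy uyy" and v: "jet2 U v vx vy vxx vxy vyy"
    and UV: "\<And>z. z \<in> U \<Longrightarrow> (u z, v z) \<in> V"
  shows "jet2 U (\<lambda>z. f (u z, v z))
    (\<lambda>z. fx (u z, v z) * ux z + fy (u z, v z) * vx z)
    (\<lambda>z. fx (u z, v z) * uy z + fy (u z, v z) * vy z)
    (\<lambda>z. fxx (u z, v z) * (ux z)\<^sup>2 + 2 * fxy (u z, v z) * ux z * vx z + fyy (u z, v z) * (vx z)\<^sup>2
       + fx (u z, v z) * uxx z + fy (u z, v z) * vxx z)
    (\<lambda>z. fxx (u z, v z) * ux z * uy z + fxy (u z, v z) * (ux z * vy z + uy z * vx z) + fyy (u z, v z) * vx z * vy z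
       + fx (u z, v z) * uxy z + fy (u z, v z) * vxy z)
    (\<lambda>z. fxx (u z, v z) * (uy z)\<^sup>2 + 2 * fxy (u z, v z) * uy z * vy z + fyy (u z, v z) * (vy z)\<^sup>2
       + fx (u z, v z) * uyy z + fy (u z, v z) * vyy z)"
  unfolding jet2_def
proof (intro ballI conjI)
  fix z assume z: "z \<in> U"
  have F: "has_partials f (fx (u z, v z)) (fy (u z, v z)) (u z, v z)"
      "has_partials fx (fxx (u z, v z)) (fxy (u z, v z)) (u z, v z)"
      "has_partials fy (fxy (u z, v z)) (fyy (u z, v z)) (u z, v z)"
    using f UV[OF z] by (auto simp: jet2_def)
  have u': "has_partials u (ux z) (uy z) z" "has_partials ux (uxx z) (uxy z) z" "has_partials uy (uxy z) (uyy z) z"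
    using u z by (auto simp: jet2_def)
  have v': "has_partials v (vx z) (vy z) z" "has_partials vx (vxx z) (vxy z) z" "has_partials vy (vxy z) (vyy z) z"
    using v z by (auto simp: jet2_def)
  note C = F[THEN has_partials_compose[OF _ u'(1) v'(1)]]
  show "has_partials (\<lambda>z. f (u z, v z)) (fx (u z, v z) * ux z + fy (u z, v z) * vx z)
     (fx (u z, v z) * uy z + fy (u z, v z) * vy z) z" by (rule C(1))
  show "has_partials (\<lambda>z. fx (u z, v z) * ux z + fy (u z, v z) * vx z)
      (fxx (u z, v z) * (ux z)\<^sup>2 + 2 * fxy (u z, v z) * ux z * vx z + fyy (u z, v z) * (vx z)\<^sup>2
       + fx (u z, v z) * uxx z + fy (u z, v z) * vxx z)
      (fxx (u z, v z) * ux z * uy z + fxy (u z, v z) * (ux z * vy z + uy z * vx z) + fyy (u z, v z) * vx z * vy z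
       + fx (u z, v z) * uxy z + fy (u z, v z) * vxy z) z"
    by (rule has_derivative_eq_rhs[OF has_partials_add[OF has_partials_mult[OF C(2) u'(2)] has_partials_mult[OF C(3) v'(2)]]])
       (simp add: fun_eq_iff algebra_simps power2_eq_square)
  show "has_partials (\<lambda>z. fx (u z, v z) * uy z + fy (u z, v z) * vy z)
      (fxx (u z, v z) * ux z * uy z + fxy (u z, v z) * (ux z * vy z + uy z * vx z) + fyy (u z, v z) * vx z * vy z
       + fx (u z, v z) * uxy z + fy (u z, v z) * vxy z)
      (fxx (u z, v z) * (uy z)\<^sup>2 + 2 * fxy (u z, v z) * uy z * vy z + fyy (u z, v z) * (vy z)\<^sup>2
       + fx (u z, v z) * uyy z + fy (u z, v z) * vyy z) z"
    by (rule has_derivative_eq_rhs[OF has_partials_add[OF has_partials_mult[OF C(2) u'(3)] has_partials_mult[OF C(3) v'(3)]]])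
       (simp add: fun_eq_iff algebra_simps power2_eq_square)
qed

lemma jet2_cong:
  assumes f: "jet2 U f fx fy fxx fxy fyy" and "open U" "\<And>z. z \<in> U \<Longrightarrow> f z = g z"
  shows "jet2 U g fx fy fxx fxy fyy"
  using f has_partials_cong[where g=g, OF _ assms(2) _ assms(3)] unfolding jet2_def by simp

lemma jet2_unique:
  assumes "jet2 U f fx fy fxx fxy fyy" "jet2 U f gx gy gxx gxy gyy" "open U" "z \<in> U"
  shows "fx z = gx z" "fy z = gy z" "fxx z = gxx z" "fxy z = gxy z" "fyy z = gyy z"
proof -
  have f: "has_partials f (fx w) (fy w) w" "has_partials fx (fxx w) (fxy w) w" "has_partials fy (fxy w) (fyy w) w"
    and g: "has_partials f (gx w) (gy w) w" "has_partials gx (gxx w) (gxy w) w" "has_partials gy (gxy w) (gyy w) w"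
    if "w \<in> U" for w
    using assms(1,2) that unfolding jet2_def by blast+
  have x: "fx w = gx w" and y: "fy w = gy w" if "w \<in> U" for w
    using has_partials_unique[OF f(1)[OF that] g(1)[OF that]] by blast+
  show "fx z = gx z" "fy z = gy z" using assms(4) by (rule x, rule y)
  have "has_partials gx (fxx z) (fxy z) z"
    using f(2)[OF assms(4)] assms(3,4) x by (rule has_partials_cong)
  from has_partials_unique[OF this g(2)[OF assms(4)]] show "fxx z = gxx z" "fxy z = gxy z" .
  have "has_partials gy (fxy z) (fyy z) z"
    using f(3)[OF assms(4)] assms(3,4) y by (rule has_partials_cong)
  from has_partials_unique(2)[OF this g(3)[OF assms(4)]] show "fyy z = gyy z" .
qed

lemma jet2_linear_combination:
  assumes f: "\<And>i. i \<in> I \<Longrightarrow> jet2 U (f i) (fx i) (fy i) (fxx i) (fxy i) (fyy i)"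
  shows "jet2 U (\<lambda>z. \<Sum>i\<in>I. f i z * c i) (\<lambda>z. \<Sum>i\<in>I. fx i z * c i) (\<lambda>z. \<Sum>i\<in>I. fy i z * c i)
    (\<lambda>z. \<Sum>i\<in>I. fxx i z * c i) (\<lambda>z. \<Sum>i\<in>I. fxy i z * c i) (\<lambda>z. \<Sum>i\<in>I. fyy i z * c i)"
proof -
  have scale: "has_partials (\<lambda>w. g w * k) (a * k) (b * k) z" if "has_partials g a b z" for g a b k z
    using has_partials_mult[OF that, of "\<lambda>_. k" 0 0] by simp
  show ?thesis
    unfolding jet2_def by (intro ballI conjI has_partials_sum scale) (use f in \<open>auto simp: jet2_def\<close>)
qed

section \<open>Harmonic functions as real parts\<close>

text \<open>
  By the Cauchy-Riemann equations \<open>hx - \<i> hy\<close> is holomorphic, and the disc is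
  convex, so it has a primitive. The primitive has the same gradient in its real part as
  \<open>h\<close>.
\<close>

lemma harmonic_imp_holomorphic_real_part:
  assumes h: "jet2 (ball 0 1) h hx hy hxx hxy hyy" and harm: "\<And>z. z \<in> ball 0 1 \<Longrightarrow> hxx z + hyy z = 0"
  obtains p where "p holomorphic_on ball 0 1" "\<And>z. z \<in> ball 0 1 \<Longrightarrow> Re (p z) = h (Re z, Im z)"
    "deriv p 0 = Complex (hx 0) (- hy 0)" "deriv (deriv p) 0 = Complex (hxx 0) (- hxy 0)"
proof -
  let ?r = "\<lambda>z. (Re z, Im z)"
  have r: "?r z \<in> ball 0 1 \<longleftrightarrow> z \<in> ball 0 1" for z by (simp add: norm_Pair cmod_def)
  have comp: "((\<lambda>z. f (?r z)) has_derivative (\<lambda>v. Re v * a + Im v * b)) (at z)" if "has_partials f a b (?r z)" for f a b z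
  proof -
    have "(?r has_derivative ?r) (at z)" by (auto intro!: derivative_eq_intros)
    from has_derivative_compose[OF this that] show ?thesis by simp
  qed
  define q where "q = (\<lambda>z. complex_of_real (hx (?r z)) - \<i> * complex_of_real (hy (?r z)))"
  have q_deriv: "(q has_field_derivative Complex (hxx (?r z)) (- hxy (?r z))) (at z)" if z: "z \<in> ball 0 1" for z
  proof -
    have rz: "?r z \<in> ball 0 1" using z r by blast
    have d: "((\<lambda>z. hx (?r z)) has_derivative (\<lambda>v. Re v * hxx (?r z) + Im v * hxy (?r z))) (at z)"
        "((\<lambda>z. hy (?r z)) has_derivative (\<lambda>v. Re v * hxy (?r z) + Im v * hyy (?r z))) (at z)"
      using h rz unfolding jet2_def by (intro comp; auto)+
    have "(q has_derivative (\<lambda>v. complex_of_real (Re v * hxx (?r z) + Im v * hxy (?r z))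
        - \<i> * complex_of_real (Re v * hxy (?r z) + Im v * hyy (?r z)))) (at z)"
      unfolding q_def by (intro has_derivative_diff has_derivative_mult_right has_derivative_of_real d)
    moreover have "hyy (?r z) = - hxx (?r z)" using harm[OF rz] by simp
    ultimately show ?thesis
      unfolding has_field_derivative_def
      by (elim has_derivative_eq_rhs) (simp add: fun_eq_iff complex_eq_iff algebra_simps)
  qed
  then have "q holomorphic_on ball 0 1" using holomorphic_on_open[OF open_ball] by blast
  then obtain P where P: "\<And>z. z \<in> ball 0 1 \<Longrightarrow> (P has_field_derivative q z) (at z)"
    using holomorphic_convex_primitive'[OF convex_ball open_ball, of q 0 1] by (metis at_within_open open_ball)
  have "\<exists>c. \<forall>z\<in>ball 0 1. Re (P z) - h (?r z) = c"
  proof (rule has_derivative_zero_constant[OF convex_ball])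
    fix z :: complex assume z: "z \<in> ball 0 1"
    have "?r z \<in> ball 0 1" using z r by blast
    then have "((\<lambda>z. h (?r z)) has_derivative (\<lambda>v. Re v * hx (?r z) + Im v * hy (?r z))) (at z)"
      using h unfolding jet2_def by (intro comp) auto
    moreover have "((\<lambda>z. Re (P z)) has_derivative (\<lambda>v. Re (q z * v))) (at z)"
      using P[OF z] unfolding has_field_derivative_def by (rule has_derivative_Re)
    ultimately have "((\<lambda>z. Re (P z) - h (?r z)) has_derivative (\<lambda>v. Re (q z * v) - (Re v * hx (?r z) + Im v * hy (?r z)))) (at z)"
      by (intro has_derivative_diff)
    then have "((\<lambda>z. Re (P z) - h (?r z)) has_derivative (\<lambda>v. 0)) (at z)"
      by (rule has_derivative_eq_rhs) (simp add: fun_eq_iff q_def algebra_simps)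
    then show "((\<lambda>z. Re (P z) - h (?r z)) has_derivative (\<lambda>v. 0)) (at z within ball 0 1)"
      by (rule has_derivative_at_withinI)
  qed
  then obtain c where c: "\<And>z. z \<in> ball 0 1 \<Longrightarrow> Re (P z) - h (?r z) = c" by blast
  define p where "p = (\<lambda>z. P z - of_real c)"
  have p_deriv: "(p has_field_derivative q z) (at z)" if "z \<in> ball 0 1" for z
    unfolding p_def using P[OF that] by (auto intro!: derivative_eq_intros)
  then have dp: "deriv p z = q z" if "z \<in> ball 0 1" for z using that by (auto intro: DERIV_imp_deriv)
  have "(deriv p has_field_derivative Complex (hxx (?r 0)) (- hxy (?r 0))) (at 0)"
    by (rule has_field_derivative_transform_within_open[OF q_deriv, where S="ball 0 1"]) (auto simp: dp)
  then have dp2: "deriv (deriv p) 0 = Complex (hxx (?r 0)) (- hxy (?r 0))" by (rule DERIV_imp_deriv)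
  show thesis
  proof (rule that[of p])
    show "p holomorphic_on ball 0 1" using p_deriv holomorphic_on_open[OF open_ball] by blast
    show "Re (p z) = h (?r z)" if "z \<in> ball 0 1" for z using c[OF that] by (simp add: p_def)
    show "deriv p 0 = Complex (hx 0) (- hy 0)" using dp[of 0] by (simp add: q_def complex_eq_iff zero_prod_def)
    show "deriv (deriv p) 0 = Complex (hxx 0) (- hxy 0)" using dp2 by (simp add: zero_prod_def)
  qed
qed

section \<open>Conformal parametrizations of minimal graphs\<close>

lemma dot_commute: "dot n a b = dot n b a"
  by (simp add: dot_def mult.commute)

lemma dot_linear:
  assumes "\<And>i. i \<in> {1..n} \<Longrightarrow> a i = s * b i + t * c i"
  shows "dot n a x = s * dot n b x + t * dot n c x"
proof -
  have "dot n a x = (\<Sum>i=1..n. s * (b i * x i) + t * (c i * x i))"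
    unfolding dot_def by (intro sum.cong) (simp_all add: assms algebra_simps)
  then show ?thesis by (simp add: dot_def sum.distrib sum_distrib_left)
qed

lemma dot_self_eq_0: "dot n a a = 0 \<Longrightarrow> i \<in> {1..n} \<Longrightarrow> a i = 0"
  by (simp add: dot_def sum_nonneg_eq_0_iff)

lemma enorm_square: "(enorm n a)\<^sup>2 = dot n a a"
  unfolding enorm_def by (simp add: dot_def sum_nonneg)

lemma dot_le_enorm: "\<bar>dot n a b\<bar> \<le> enorm n a * enorm n b"
proof -
  have "(dot n a b)\<^sup>2 \<le> dot n a a * dot n b b"
    using Cauchy_Schwarz_ineq_sum[of a b "{1..n}"] by (simp add: dot_def power2_eq_square)
  then have "sqrt ((dot n a b)\<^sup>2) \<le> sqrt (dot n a a * dot n b b)" by (rule real_sqrt_le_mono)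
  then show ?thesis by (simp add: enorm_def real_sqrt_mult)
qed

lemma vdiff_component: "vdiff S j X z i = pdiff S j (\<lambda>w. X w i) z"
  by (simp add: vdiff_def)

lemma vdiff2_component: "vdiff2 S j k X z i = pdiff S k (pdiff S j (\<lambda>w. X w i)) z"
  by (simp add: vdiff2_def vdiff_def)

lemma conformal_reparam_jet2:
  fixes S :: "(real \<times> real) set"
  defines "S \<equiv> cball 0 1"
  assumes conf: "conformal_reparam n T X S Y F" and j: "j \<in> {1..n}"
  shows "jet2 (ball 0 1) (\<lambda>p. Y p j) (\<lambda>p. vdiff S 1 Y p j) (\<lambda>p. vdiff S 2 Y p j)
      (\<lambda>p. vdiff2 S 1 1 Y p j) (\<lambda>p. vdiff2 S 1 2 Y p j) (\<lambda>p. vdiff2 S 2 2 Y p j)"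
proof -
  have "Ck_on 3 (cball 0 1) (\<lambda>z. Y z j)" using conf j unfolding conformal_reparam_def S_def by blast
  then show ?thesis
    unfolding vdiff_component vdiff2_component S_def by (rule Ck_on_imp_jet2) (erule jet2_pdiff(1))
qed

text \<open>
  Differentiating \<open>Yu \<bullet> Yu = Yv \<bullet> Yv\<close> and \<open>Yu \<bullet> Yv =
  0\<close> shows that the Laplacian of a conformal parametrization has no tangential component.
\<close>

lemma conformal_laplacian_normal:
  assumes U: "open U" "z \<in> U"
    and Y: "\<And>i. i \<in> {1..n} \<Longrightarrow> jet2 U (\<lambda>w. Y w i) (\<lambda>w. Yu w i) (\<lambda>w. Yv w i)
        (\<lambda>w. Yuu w i) (\<lambda>w. Yuv w i) (\<lambda>w. Yvv w i)"
    and eq: "\<And>w. w \<in> U \<Longrightarrow> dot n (Yu w) (Yu w) = dot n (Yv w) (Yv w)"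
    and orth: "\<And>w. w \<in> U \<Longrightarrow> dot n (Yu w) (Yv w) = 0"
  shows "dot n (\<lambda>i. Yuu z i + Yvv z i) (Yu z) = 0" "dot n (\<lambda>i. Yuu z i + Yvv z i) (Yv z) = 0"
proof -
  have d: "has_partials (\<lambda>w. Yu w i) (Yuu z i) (Yuv z i) z" "has_partials (\<lambda>w. Yv w i) (Yuv z i) (Yvv z i) z"
    if "i \<in> {1..n}" for i
    using Y[OF that] U(2) by (auto simp: jet2_def)
  have prod: "has_partials (\<lambda>w. dot n (A w) (B w)) (dot n Au (B z) + dot n (A z) Bu) (dot n Av (B z) + dot n (A z) Bv) z"
    if "\<And>i. i \<in> {1..n} \<Longrightarrow> has_partials (\<lambda>w. A w i) (Au i) (Av i) z"
       "\<And>i. i \<in> {1..n} \<Longrightarrow> has_partials (\<lambda>w. B w i) (Bu i) (Bv i) z" for A B Au Av Bu Bv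
    unfolding dot_def sum.distrib[symmetric]
    by (intro has_partials_sum has_partials_mult that)
  have "has_partials (\<lambda>w. dot n (Yv w) (Yv w)) (dot n (Yuu z) (Yu z) + dot n (Yu z) (Yuu z))
     (dot n (Yuv z) (Yu z) + dot n (Yu z) (Yuv z)) z"
    by (rule has_partials_cong[OF prod[OF d(1) d(1)] U]) (simp_all add: eq)
  from has_partials_unique[OF this prod[OF d(2) d(2)]]
  have 1: "dot n (Yuu z) (Yu z) = dot n (Yuv z) (Yv z)" "dot n (Yuv z) (Yu z) = dot n (Yvv z) (Yv z)"
    by (simp_all add: dot_commute)
  have "has_partials (\<lambda>w. 0) (dot n (Yuu z) (Yv z) + dot n (Yu z) (Yuv z))
     (dot n (Yuv z) (Yv z) + dot n (Yu z) (Yvv z)) z"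
    by (rule has_partials_cong[OF prod[OF d(1) d(2)] U]) (simp_all add: orth)
  moreover have "has_partials (\<lambda>w. 0) 0 0 z" by simp
  ultimately have "dot n (Yuu z) (Yv z) + dot n (Yu z) (Yuv z) = 0" "dot n (Yuv z) (Yv z) + dot n (Yu z) (Yvv z) = 0"
    by (rule has_partials_unique)+
  then have 2: "dot n (Yuu z) (Yv z) + dot n (Yuv z) (Yu z) = 0" "dot n (Yuv z) (Yv z) + dot n (Yvv z) (Yu z) = 0"
    unfolding dot_commute[of n "Yu z"] .
  have "dot n (\<lambda>i. Yuu z i + Yvv z i) V = dot n (Yuu z) V + dot n (Yvv z) V" for V
    using dot_linear[of n "\<lambda>i. Yuu z i + Yvv z i" 1 "Yuu z" 1 "Yvv z" V] by simp
  then show "dot n (\<lambda>i. Yuu z i + Yvv z i) (Yu z) = 0" "dot n (\<lambda>i. Yuu z i + Yvv z i) (Yv z) = 0"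
    using 1 2 by simp_all
qed

text \<open>
  The algebra at one point. Here \<open>E, F, G\<close> is the first fundamental form of
  \<open>X\<close>, the matrix with rows \<open>(a, b)\<close> and \<open>(c, d)\<close> is the
  Jacobian of the parameter change, and \<open>D\<close> is the Laplacian of the reparametrized
  surface. Conformality says that the Jacobian pulls the form back to \<open>W\<close> times the
  identity, and solving this for the form identifies the coefficients of \<open>D\<close> with those
  of the mean curvature operator. Up to tangential terms \<open>D\<close> is therefore the mean
  curvature vector, which makes \<open>D\<close> tangential; being also orthogonal to the tangent
  plane, it vanishes.
\<close>

lemma tangential_and_normal_imp_zero:
  fixes n :: nat and Xx Xy Xxx Xxy Xyy D :: vec_n and a b c d W :: real
  defines "E \<equiv> dot n Xx Xx" and "F \<equiv> dot n Xx Xy" and "G \<equiv> dot n Xy Xy"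
  assumes W: "0 < W"
    and uu: "E * a\<^sup>2 + 2 * F * a * c + G * c\<^sup>2 = W"
    and vv: "E * b\<^sup>2 + 2 * F * b * d + G * d\<^sup>2 = W"
    and uv: "E * a * b + F * (a * d + b * c) + G * c * d = 0"
    and D: "\<And>i. i \<in> {1..n} \<Longrightarrow> D i = (a\<^sup>2 + b\<^sup>2) * Xxx i + 2 * (a * c + b * d) * Xxy i
              + (c\<^sup>2 + d\<^sup>2) * Xyy i + l * Xx i + m * Xy i"
    and min: "\<And>i. i \<in> {1..n} \<Longrightarrow> G * Xxx i - 2 * F * Xxy i + E * Xyy i = p * Xx i + q * Xy i"
    and normal: "dot n D Xx = 0" "dot n D Xy = 0"
    and i: "i \<in> {1..n}"
  shows "D i = 0"
proof -
  define \<delta> where "\<delta> = a * d - b * c"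
  have inv: "E * \<delta>\<^sup>2 = W * (c\<^sup>2 + d\<^sup>2)" "G * \<delta>\<^sup>2 = W * (a\<^sup>2 + b\<^sup>2)" "F * \<delta>\<^sup>2 = - W * (a * c + b * d)"
  proof -
    have "E * \<delta>\<^sup>2 = d\<^sup>2 * (E * a\<^sup>2 + 2 * F * a * c + G * c\<^sup>2) + c\<^sup>2 * (E * b\<^sup>2 + 2 * F * b * d + G * d\<^sup>2)
        - 2 * c * d * (E * a * b + F * (a * d + b * c) + G * c * d)"
      unfolding \<delta>_def by (simp add: power2_eq_square algebra_simps)
    then show "E * \<delta>\<^sup>2 = W * (c\<^sup>2 + d\<^sup>2)" unfolding uu vv uv by (simp add: algebra_simps)
    have "G * \<delta>\<^sup>2 = b\<^sup>2 * (E * a\<^sup>2 + 2 * F * a * c + G * c\<^sup>2) + a\<^sup>2 * (E * b\<^sup>2 + 2 * F * b * d + G * d\<^sup>2)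
        - 2 * a * b * (E * a * b + F * (a * d + b * c) + G * c * d)"
      unfolding \<delta>_def by (simp add: power2_eq_square algebra_simps)
    then show "G * \<delta>\<^sup>2 = W * (a\<^sup>2 + b\<^sup>2)" unfolding uu vv uv by (simp add: algebra_simps)
    have "F * \<delta>\<^sup>2 = - b * d * (E * a\<^sup>2 + 2 * F * a * c + G * c\<^sup>2) - a * c * (E * b\<^sup>2 + 2 * F * b * d + G * d\<^sup>2)
        + (a * d + b * c) * (E * a * b + F * (a * d + b * c) + G * c * d)"
      unfolding \<delta>_def by (simp add: power2_eq_square algebra_simps)
    then show "F * \<delta>\<^sup>2 = - W * (a * c + b * d)" unfolding uu vv uv by (simp add: algebra_simps)
  qed
  have tangential: "D j = ((\<delta>\<^sup>2 * p) / W + l) * Xx j + ((\<delta>\<^sup>2 * q) / W + m) * Xy j" if j: "j \<in> {1..n}" for j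
  proof -
    have "W * D j = (W * (a\<^sup>2 + b\<^sup>2)) * Xxx j - 2 * (- W * (a * c + b * d)) * Xxy j + (W * (c\<^sup>2 + d\<^sup>2)) * Xyy j
        + W * l * Xx j + W * m * Xy j"
      unfolding D[OF j] by (simp add: algebra_simps)
    also have "\<dots> = \<delta>\<^sup>2 * (G * Xxx j - 2 * F * Xxy j + E * Xyy j) + W * l * Xx j + W * m * Xy j"
      unfolding inv[symmetric] by (simp add: algebra_simps)
    also have "\<dots> = W * (((\<delta>\<^sup>2 * p) / W + l) * Xx j + ((\<delta>\<^sup>2 * q) / W + m) * Xy j)"
      unfolding min[OF j] using W by (simp add: field_simps)
    finally show ?thesis using W by simp
  qed
  have "dot n D D = ((\<delta>\<^sup>2 * p) / W + l) * dot n Xx D + ((\<delta>\<^sup>2 * q) / W + m) * dot n Xy D"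
    by (rule dot_linear) (rule tangential)
  then have "dot n D D = 0" using normal by (simp add: dot_commute)
  then show ?thesis using i by (rule dot_self_eq_0)
qed

text \<open>
  A vector whose normal part vanishes is a combination of the two tangent vectors.
\<close>

lemma minimal_imp_tangential:
  assumes "minimal_surface n S X" "z \<in> S" and area: "0 < area_element n S X z"
  obtains p q where "\<And>i. i \<in> {1..n} \<Longrightarrow>
    gform n S X 2 2 z * vdiff2 S 1 1 X z i - 2 * gform n S X 1 2 z * vdiff2 S 1 2 X z i
      + gform n S X 1 1 z * vdiff2 S 2 2 X z i = p * vdiff S 1 X z i + q * vdiff S 2 X z i"
proof -
  define V where "V = (\<lambda>i. (gform n S X 2 2 z * vdiff2 S 1 1 X z i
            - 2 * gform n S X 1 2 z * vdiff2 S 1 2 X z i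
            + gform n S X 1 1 z * vdiff2 S 2 2 X z i) / (2 * (area_element n S X z)\<^sup>2))"
  have "normal_part n S X z V i = 0" if "i \<in> {1..n}" for i
    using assms that unfolding minimal_surface_def mean_curvature_vector_def V_def by blast
  then obtain p q where pq: "\<And>i. i \<in> {1..n} \<Longrightarrow> V i - p * vdiff S 1 X z i - q * vdiff S 2 X z i = 0"
    unfolding normal_part_def Let_def by blast
  let ?k = "2 * (area_element n S X z)\<^sup>2"
  show thesis
  proof (rule that[of "?k * p" "?k * q"])
    fix i assume i: "i \<in> {1..n}"
    have "gform n S X 2 2 z * vdiff2 S 1 1 X z i - 2 * gform n S X 1 2 z * vdiff2 S 1 2 X z i
      + gform n S X 1 1 z * vdiff2 S 2 2 X z i = ?k * V i"
      using area by (simp add: V_def)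
    also have "V i = p * vdiff S 1 X z i + q * vdiff S 2 X z i" using pq[OF i] by simp
    finally show "gform n S X 2 2 z * vdiff2 S 1 1 X z i - 2 * gform n S X 1 2 z * vdiff2 S 1 2 X z i
      + gform n S X 1 1 z * vdiff2 S 2 2 X z i = ?k * p * vdiff S 1 X z i + ?k * q * vdiff S 2 X z i"
      by (simp add: algebra_simps)
  qed
qed

lemma graph_map_jet2:
  assumes \<phi>: "\<And>s. s \<in> {1..n - 2} \<Longrightarrow> Ck_on 3 (cball 0 R) (\<phi> s)" and i: "i \<in> {1..n}"
  obtains fx fy fxx fxy fyy where "jet2 (ball 0 R) (\<lambda>p. graph_map \<phi> p i) fx fy fxx fxy fyy"
proof -
  consider "i = 1" | "i = 2" | "i \<noteq> 1" "i \<noteq> 2" by blast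
  then show thesis
  proof cases
    case 1
    have "jet2 (ball 0 R) (\<lambda>p. graph_map \<phi> p i) (\<lambda>_. 1) (\<lambda>_. 0) (\<lambda>_. 0) (\<lambda>_. 0) (\<lambda>_. 0)"
      unfolding jet2_def graph_map_def 1 by (auto intro!: derivative_eq_intros)
    then show ?thesis by (rule that)
  next
    case 2
    have "jet2 (ball 0 R) (\<lambda>p. graph_map \<phi> p i) (\<lambda>_. 0) (\<lambda>_. 1) (\<lambda>_. 0) (\<lambda>_. 0) (\<lambda>_. 0)"
      unfolding jet2_def graph_map_def 2 by (auto intro!: derivative_eq_intros)
    then show ?thesis by (rule that)
  next
    case 3
    then have "i - 2 \<in> {1..n - 2}" using i by auto
    from Ck_on_imp_jet2[OF \<phi>[OF this]] obtain fx fy fxx fxy fyy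
      where "jet2 (ball 0 R) (\<phi> (i - 2)) fx fy fxx fxy fyy" .
    moreover have "(\<lambda>p. graph_map \<phi> p i) = \<phi> (i - 2)" using 3 by (simp add: graph_map_def)
    ultimately show ?thesis using that by metis
  qed
qed

text \<open>
  The first two components of a graph are the base point, so \<open>F\<close> consists of two
  components of \<open>Y\<close> and inherits their continuity; compactness gives the continuous
  inverse.
\<close>

lemma conformal_reparam_homeomorphism:
  assumes n: "3 \<le> n" and conf: "conformal_reparam n (cball 0 R) (graph_map \<phi>) (cball 0 1) Y F"
  obtains G where "homeomorphism (cball 0 1) (cball 0 R) F G"
proof -
  have "F z = (Y z 1, Y z 2)" if "z \<in> cball 0 1" for z
  proof -
    have "1 \<in> {1..n}" "2 \<in> {1..n}" using n by auto
    then have "Y z 1 = graph_map \<phi> (F z) 1" "Y z 2 = graph_map \<phi> (F z) 2"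
      using conf that unfolding conformal_reparam_def by blast+
    then show ?thesis by (simp add: graph_map_def)
  qed
  moreover have "continuous_on (cball 0 1) (\<lambda>z. (Y z 1, Y z 2))"
  proof (rule continuous_on_Pair)
    have "Ck_on 3 (cball 0 1) (\<lambda>z. Y z i)" if "i \<in> {1..n}" for i
      using conf that unfolding conformal_reparam_def by blast
    then have "(\<lambda>z. Y z i) differentiable_on cball 0 1" if "i \<in> {1..n}" for i
      using that by (simp add: numeral_3_eq_3)
    then show "continuous_on (cball 0 1) (\<lambda>z. Y z 1)" "continuous_on (cball 0 1) (\<lambda>z. Y z 2)"
      using n by (auto intro!: differentiable_imp_continuous_on)
  qed
  ultimately have "continuous_on (cball 0 1) F" by (metis (no_types, lifting) continuous_on_cong)
  then show thesis
    using conf homeomorphism_compact[of "cball 0 1" F "cball 0 R"] that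
    unfolding conformal_reparam_def bij_betw_def by auto
qed

text \<open>
  The parameter change has the first two components of \<open>Y\<close> as its coordinates, so the
  chain rule for \<open>Y = X \<circ> F\<close> can be written entirely in derivatives of
  \<open>Y\<close> and of \<open>X\<close>. Its second-order form, together with the nonvanishing of
  the Jacobian, is the input of the pointwise algebra.
\<close>

lemma conformal_minimal_harmonic:
  assumes n: "3 \<le> n"
    and \<phi>: "\<And>s. s \<in> {1..n - 2} \<Longrightarrow> Ck_on 3 (cball 0 R) (\<phi> s)"
    and minimal: "minimal_surface n (cball 0 R) (graph_map \<phi>)"
    and conf: "conformal_reparam n (cball 0 R) (graph_map \<phi>) (cball 0 1) Y F"
    and z: "z \<in> ball 0 1" and i: "i \<in> {1..n}"
  shows "vdiff2 (cball 0 1) 1 1 Y z i + vdiff2 (cball 0 1) 2 2 Y z i = 0"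
proof -
  define S where "S = (cball 0 1 :: (real \<times> real) set)"
  define T where "T = (cball 0 R :: (real \<times> real) set)"
  define X where "X = graph_map \<phi>"
  obtain G where hom: "homeomorphism (cball 0 1) (cball 0 R) F G"
    using conformal_reparam_homeomorphism[OF n conf] .
  have F_ball: "F w \<in> ball 0 R" if "w \<in> ball 0 1" for w
    using disc_homeomorphism_interior[OF hom zero_less_one] that by blast
  have YX: "Y w j = X (F w) j" if "w \<in> S" "j \<in> {1..n}" for w j
    using conf that unfolding conformal_reparam_def X_def S_def by blast
  have Xjet: "jet2 (ball 0 R) (\<lambda>p. X p j) (\<lambda>p. vdiff T 1 X p j) (\<lambda>p. vdiff T 2 X p j)
      (\<lambda>p. vdiff2 T 1 1 X p j) (\<lambda>p. vdiff2 T 1 2 X p j) (\<lambda>p. vdiff2 T 2 2 X p j)" if "j \<in> {1..n}" for j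
    unfolding vdiff_component vdiff2_component T_def X_def
    by (rule graph_map_jet2[OF \<phi> that]) (assumption | erule jet2_pdiff(1))+
  note Yjet = conformal_reparam_jet2[OF conf, folded S_def]
  have n12: "1 \<in> {1..n}" "2 \<in> {1..n}" using n by auto
  have ball_S: "w \<in> S" if "w \<in> ball 0 1" for w using that by (auto simp: S_def)
  have ujet: "jet2 (ball 0 1) (\<lambda>p. fst (F p)) (\<lambda>p. vdiff S 1 Y p 1) (\<lambda>p. vdiff S 2 Y p 1)
      (\<lambda>p. vdiff2 S 1 1 Y p 1) (\<lambda>p. vdiff2 S 1 2 Y p 1) (\<lambda>p. vdiff2 S 2 2 Y p 1)"
    by (rule jet2_cong[OF Yjet[OF n12(1)] open_ball]) (simp only: YX[OF ball_S n12(1)], simp add: X_def graph_map_def)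
  have vjet: "jet2 (ball 0 1) (\<lambda>p. snd (F p)) (\<lambda>p. vdiff S 1 Y p 2) (\<lambda>p. vdiff S 2 Y p 2)
      (\<lambda>p. vdiff2 S 1 1 Y p 2) (\<lambda>p. vdiff2 S 1 2 Y p 2) (\<lambda>p. vdiff2 S 2 2 Y p 2)"
    by (rule jet2_cong[OF Yjet[OF n12(2)] open_ball]) (simp only: YX[OF ball_S n12(2)], simp add: X_def graph_map_def)
  define a b c d where "a = vdiff S 1 Y z 1" and "b = vdiff S 2 Y z 1" and "c = vdiff S 1 Y z 2" and "d = vdiff S 2 Y z 2"
  define w where "w = F z"
  define D where "D = (\<lambda>j. vdiff2 S 1 1 Y z j + vdiff2 S 2 2 Y z j)"
  have chain: "vdiff S 1 Y z j = a * vdiff T 1 X w j + c * vdiff T 2 X w j"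
      "vdiff S 2 Y z j = b * vdiff T 1 X w j + d * vdiff T 2 X w j"
      "D j = (a\<^sup>2 + b\<^sup>2) * vdiff2 T 1 1 X w j + 2 * (a * c + b * d) * vdiff2 T 1 2 X w j
              + (c\<^sup>2 + d\<^sup>2) * vdiff2 T 2 2 X w j + D 1 * vdiff T 1 X w j + D 2 * vdiff T 2 X w j"
    if j: "j \<in> {1..n}" for j
  proof -
    have "(fst (F p), snd (F p)) \<in> ball 0 R" if "p \<in> ball 0 1" for p using F_ball[OF that] by simp
    note comp = jet2_compose[OF Xjet[OF j] ujet vjet this, unfolded prod.collapse]
    have "X (F p) j = Y p j" if "p \<in> ball 0 1" for p using YX[OF ball_S[OF that] j] by simp
    note eqs = jet2_unique[OF Yjet[OF j] jet2_cong[OF comp open_ball this] open_ball z]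
    show "vdiff S 1 Y z j = a * vdiff T 1 X w j + c * vdiff T 2 X w j"
        "vdiff S 2 Y z j = b * vdiff T 1 X w j + d * vdiff T 2 X w j"
      using eqs(1,2) unfolding a_def b_def c_def d_def w_def by (simp_all only: mult.commute)
    show "D j = (a\<^sup>2 + b\<^sup>2) * vdiff2 T 1 1 X w j + 2 * (a * c + b * d) * vdiff2 T 1 2 X w j
              + (c\<^sup>2 + d\<^sup>2) * vdiff2 T 2 2 X w j + D 1 * vdiff T 1 X w j + D 2 * vdiff T 2 X w j"
      using arg_cong2[where f="(+)", OF eqs(3) eqs(5)] unfolding D_def a_def b_def c_def d_def w_def
      by (simp only: algebra_simps)
  qed
  define E1 where "E1 = dot n (vdiff T 1 X w) (vdiff T 1 X w)"
  define F1 where "F1 = dot n (vdiff T 1 X w) (vdiff T 2 X w)"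
  define G1 where "G1 = dot n (vdiff T 2 X w) (vdiff T 2 X w)"
  define W where "W = area_element n S Y z"
  have first_form: "(enorm n (vdiff S 1 Y p))\<^sup>2 = area_element n S Y p"
      "(enorm n (vdiff S 2 Y p))\<^sup>2 = area_element n S Y p"
      "dot n (vdiff S 1 Y p) (vdiff S 2 Y p) = 0" "0 < area_element n S Y p" if "p \<in> S" for p
    using conf that unfolding conformal_reparam_def S_def by blast+
  have F1': "dot n (vdiff T 2 X w) (vdiff T 1 X w) = F1" by (simp add: F1_def dot_commute)
  have expand: "dot n (vdiff S 1 Y z) V = a * dot n (vdiff T 1 X w) V + c * dot n (vdiff T 2 X w) V"
      "dot n (vdiff S 2 Y z) V = b * dot n (vdiff T 1 X w) V + d * dot n (vdiff T 2 X w) V"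
      "dot n V (vdiff S 1 Y z) = a * dot n V (vdiff T 1 X w) + c * dot n V (vdiff T 2 X w)"
      "dot n V (vdiff S 2 Y z) = b * dot n V (vdiff T 1 X w) + d * dot n V (vdiff T 2 X w)" for V
    using dot_linear[OF chain(1)] dot_linear[OF chain(2)] by (auto simp: dot_commute[of n V])
  have uu: "E1 * a\<^sup>2 + 2 * F1 * a * c + G1 * c\<^sup>2 = W" and vv: "E1 * b\<^sup>2 + 2 * F1 * b * d + G1 * d\<^sup>2 = W"
    and uv: "E1 * a * b + F1 * (a * d + b * c) + G1 * c * d = 0" and W: "0 < W"
    using first_form[OF ball_S[OF z]] unfolding enorm_square expand F1' W_def[symmetric]
    unfolding E1_def[symmetric] F1_def[symmetric] G1_def[symmetric]
    by (simp_all add: power2_eq_square algebra_simps)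
  \<comment> \<open>Multiplicativity of the Gram determinant: a conformal immersion forces both factors to be nonzero.\<close>
  have "(E1 * G1 - F1\<^sup>2) * (a * d - b * c)\<^sup>2
      = (E1 * a\<^sup>2 + 2 * F1 * a * c + G1 * c\<^sup>2) * (E1 * b\<^sup>2 + 2 * F1 * b * d + G1 * d\<^sup>2)
        - (E1 * a * b + F1 * (a * d + b * c) + G1 * c * d)\<^sup>2"
    by (simp add: power2_eq_square algebra_simps)
  also have "\<dots> = W * W" unfolding uu vv uv by simp
  finally have prod: "0 < (E1 * G1 - F1\<^sup>2) * (a * d - b * c)\<^sup>2" using W by simp
  then have det: "a * d - b * c \<noteq> 0" and "0 < E1 * G1 - F1\<^sup>2"
    by (auto simp: zero_less_mult_iff not_less)
  then have "0 < area_element n T X w" by (simp add: area_element_def gform_def E1_def F1_def G1_def)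
  moreover have "w \<in> T" using F_ball[OF z] by (simp add: w_def T_def)
  ultimately obtain p q where pq: "\<And>j. j \<in> {1..n} \<Longrightarrow>
    G1 * vdiff2 T 1 1 X w j - 2 * F1 * vdiff2 T 1 2 X w j + E1 * vdiff2 T 2 2 X w j = p * vdiff T 1 X w j + q * vdiff T 2 X w j"
    using minimal_imp_tangential[OF minimal[folded X_def T_def]] unfolding gform_def E1_def F1_def G1_def by blast
  have normal: "dot n D (vdiff S 1 Y z) = 0" "dot n D (vdiff S 2 Y z) = 0"
    unfolding D_def
    by (rule conformal_laplacian_normal[OF open_ball z Yjet]; use first_form[OF ball_S] in \<open>simp add: enorm_square\<close>)+
  have normal_X: "dot n D (vdiff T 1 X w) = 0" "dot n D (vdiff T 2 X w) = 0"
  proof -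
    have e: "a * dot n D (vdiff T 1 X w) + c * dot n D (vdiff T 2 X w) = 0"
        "b * dot n D (vdiff T 1 X w) + d * dot n D (vdiff T 2 X w) = 0"
      using normal unfolding expand by auto
    have "(a * d - b * c) * dot n D (vdiff T 1 X w) = d * (a * dot n D (vdiff T 1 X w) + c * dot n D (vdiff T 2 X w))
        - c * (b * dot n D (vdiff T 1 X w) + d * dot n D (vdiff T 2 X w))" by (simp add: algebra_simps)
    then show "dot n D (vdiff T 1 X w) = 0" unfolding e using det by simp
    have "(a * d - b * c) * dot n D (vdiff T 2 X w) = a * (b * dot n D (vdiff T 1 X w) + d * dot n D (vdiff T 2 X w))
        - b * (a * dot n D (vdiff T 1 X w) + c * dot n D (vdiff T 2 X w))" by (simp add: algebra_simps)
    then show "dot n D (vdiff T 2 X w) = 0" unfolding e using det by simp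
  qed
  have "D i = 0"
    by (rule tangential_and_normal_imp_zero[OF W uu[unfolded E1_def F1_def G1_def] vv[unfolded E1_def F1_def G1_def]
          uv[unfolded E1_def F1_def G1_def] chain(3) pq[unfolded E1_def F1_def G1_def] normal_X i])
  then show ?thesis by (simp add: D_def S_def)
qed

section \<open>The curvature estimate\<close>

lemma enorm_le_C0_norm:
  assumes \<phi>: "\<And>s. s \<in> {1..n - 2} \<Longrightarrow> Ck_on 3 (cball 0 R) (\<phi> s)" and p: "p \<in> cball 0 R"
  shows "enorm n (graph_map \<phi> p) \<le> C0_norm n (cball 0 R) (graph_map \<phi>)"
proof -
  have "continuous_on (cball 0 R) (\<lambda>p. graph_map \<phi> p i)" if i: "i \<in> {1..n}" for i
  proof (cases "i = 1 \<or> i = 2")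
    case True
    then show ?thesis unfolding graph_map_def by (auto intro!: continuous_intros)
  next
    case False
    then have "i - 2 \<in> {1..n - 2}" using i by auto
    from \<phi>[OF this] have "continuous_on (cball 0 R) (\<phi> (i - 2))"
      by (simp add: numeral_3_eq_3 differentiable_imp_continuous_on)
    then show ?thesis using False unfolding graph_map_def by simp
  qed
  then have "continuous_on (cball 0 R) (\<lambda>p. enorm n (graph_map \<phi> p))"
    unfolding enorm_def dot_def by (intro continuous_intros) auto
  then have "compact ((\<lambda>p. enorm n (graph_map \<phi> p)) ` cball 0 R)"
    by (rule compact_continuous_image) simp
  then have "bdd_above ((\<lambda>p. enorm n (graph_map \<phi> p)) ` cball 0 R)"
    by (intro bounded_imp_bdd_above compact_imp_bounded)
  then show ?thesis unfolding C0_norm_def using p by (rule cSUP_upper[rotated])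
qed

text \<open>
  Conformality makes \<open>2 W\<close> the sum of the squared gradients of all components of
  \<open>Y\<close>. Heinz's lemma bounds one of the first two gradients below, and
  \<open>(R/12)\<^sup>2 / 2 = R\<^sup>2 / 288\<close>.
\<close>

lemma area_element_lower_bound:
  assumes n: "3 \<le> n" and R: "0 < R"
    and \<phi>: "\<And>s. s \<in> {1..n - 2} \<Longrightarrow> Ck_on 3 (cball 0 R) (\<phi> s)"
    and minimal: "minimal_surface n (cball 0 R) (graph_map \<phi>)"
    and conf: "conformal_reparam n (cball 0 R) (graph_map \<phi>) (cball 0 1) Y F"
    and F0: "F 0 = 0"
  shows "R\<^sup>2 / 288 \<le> area_element n (cball 0 1) Y 0"
proof -
  define S where "S = (cball 0 1 :: (real \<times> real) set)"
  obtain G where hom: "homeomorphism (cball 0 1) (cball 0 R) F G"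
    using conformal_reparam_homeomorphism[OF n conf] .
  have n12: "1 \<in> {1..n}" "2 \<in> {1..n}" using n by auto
  have YF: "Y z 1 = fst (F z)" "Y z 2 = snd (F z)" if "z \<in> cball 0 1" for z
  proof -
    have "Y z j = graph_map \<phi> (F z) j" if "j \<in> {1..n}" for j
      using conf that \<open>z \<in> cball 0 1\<close> unfolding conformal_reparam_def by blast
    from this[OF n12(1)] this[OF n12(2)] show "Y z 1 = fst (F z)" "Y z 2 = snd (F z)"
      by (simp_all add: graph_map_def)
  qed
  have pot: "\<exists>p. p holomorphic_on ball 0 1 \<and> (\<forall>z\<in>ball 0 1. Re (p z) = Y (Re z, Im z) j)
      \<and> deriv p 0 = Complex (vdiff S 1 Y 0 j) (- vdiff S 2 Y 0 j)" if j: "j \<in> {1..n}" for j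
  proof -
    show ?thesis
      by (rule harmonic_imp_holomorphic_real_part[OF conformal_reparam_jet2[OF conf j]])
         (use conformal_minimal_harmonic[OF n \<phi> minimal conf _ j] in \<open>auto simp: S_def\<close>)
  qed
  obtain p q where p: "p holomorphic_on ball 0 1" "\<And>z. z \<in> ball 0 1 \<Longrightarrow> Re (p z) = Y (Re z, Im z) 1"
      "deriv p 0 = Complex (vdiff S 1 Y 0 1) (- vdiff S 2 Y 0 1)"
    and q: "q holomorphic_on ball 0 1" "\<And>z. z \<in> ball 0 1 \<Longrightarrow> Re (q z) = Y (Re z, Im z) 2"
      "deriv q 0 = Complex (vdiff S 1 Y 0 2) (- vdiff S 2 Y 0 2)"
    using pot[OF n12(1)] pot[OF n12(2)] by blast
  let ?r = "\<lambda>z. (Re z, Im z)" and ?c = "\<lambda>v. Complex (fst v) (snd v)"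
  define \<Phi> where "\<Phi> = ?c \<circ> (F \<circ> ?r)"
  have "continuous_on A ?c" for A unfolding Complex_eq by (intro continuous_intros)
  then have iso: "homeomorphism (cball 0 s) (cball 0 s) ?r ?c" for s
    by (intro homeomorphismI continuous_intros) (auto simp: norm_Pair cmod_def)
  have hom': "homeomorphism (cball 0 1) (cball 0 R) \<Phi> ((?c \<circ> G) \<circ> ?r)"
    unfolding \<Phi>_def by (rule homeomorphism_compose[OF homeomorphism_compose[OF iso hom] homeomorphism_symD[OF iso]])
  have r: "?r z \<in> cball 0 1" if "z \<in> ball 0 1" for z using that by (simp add: norm_Pair cmod_def less_imp_le)
  have "R / 12 \<le> cmod (deriv p 0) \<or> R / 12 \<le> cmod (deriv q 0)"
  proof (rule heinz_lower_bound[OF hom' R _ p(1) _ q(1)])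
    show "\<Phi> 0 = 0" using F0 by (simp add: \<Phi>_def zero_prod_def[symmetric] complex_eq_iff)
    show "Re (\<Phi> z) = Re (p z)" "Im (\<Phi> z) = Re (q z)" if "z \<in> ball 0 1" for z
      using p(2)[OF that] q(2)[OF that] YF[OF r[OF that]] by (simp_all add: \<Phi>_def)
  qed
  then obtain j where j: "j \<in> {1..n}" and "R / 12 \<le> cmod (Complex (vdiff S 1 Y 0 j) (- vdiff S 2 Y 0 j))"
    using n12 p(3) q(3) by metis
  then have "(R / 12)\<^sup>2 \<le> (cmod (Complex (vdiff S 1 Y 0 j) (- vdiff S 2 Y 0 j)))\<^sup>2"
    using R by (intro power_mono) auto
  also have "\<dots> = vdiff S 1 Y 0 j * vdiff S 1 Y 0 j + vdiff S 2 Y 0 j * vdiff S 2 Y 0 j"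
    unfolding cmod_power2 by (simp add: power2_eq_square)
  also have "\<dots> \<le> dot n (vdiff S 1 Y 0) (vdiff S 1 Y 0) + dot n (vdiff S 2 Y 0) (vdiff S 2 Y 0)"
    unfolding dot_def using j by (intro add_mono member_le_sum) auto
  also have "\<dots> = 2 * area_element n S Y 0"
    using conf unfolding conformal_reparam_def S_def enorm_square by auto
  finally show ?thesis by (simp add: S_def power2_eq_square)
qed

text \<open>
  With \<open>N\<close> fixed at its value in the origin, \<open>Y \<bullet> N 0\<close> is a scalar
  harmonic function bounded by the norm of the surface, and its second derivatives at the origin are
  the coefficients of the second fundamental form. If it is the real part of \<open>p\<close>, then
  \<open>L\<^sub>1\<^sub>1 = - L\<^sub>2\<^sub>2\<close> makes the numerator of the curvature equal
  to \<open>- \<bar>p''\<bar>\<^sup>2\<close>. Contracting with \<open>N 0\<close> first keeps the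
  constant independent of the dimension.
\<close>

lemma curvature_estimate:
  assumes n: "3 \<le> n" and R: "0 < R"
    and \<phi>: "\<And>s. s \<in> {1..n - 2} \<Longrightarrow> Ck_on 3 (cball 0 R) (\<phi> s)"
    and minimal: "minimal_surface n (cball 0 R) (graph_map \<phi>)"
    and conf: "conformal_reparam n (cball 0 R) (graph_map \<phi>) (cball 0 1) Y F"
    and F0: "F 0 = 0" and N: "unit_normal_section n (cball 0 1) Y N"
  shows "\<bar>gauss_curvature n (cball 0 1) Y N 0\<bar>
     \<le> (396 * 288)\<^sup>2 / R ^ 4 * (C0_norm n (cball 0 R) (graph_map \<phi>))\<^sup>2"
proof -
  define S where "S = (cball 0 1 :: (real \<times> real) set)"
  define M where "M = C0_norm n (cball 0 R) (graph_map \<phi>)"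
  define W where "W = area_element n S Y 0"
  \<comment> \<open>The boundary point \<open>(R, 0)\<close> makes the norm positive, as the exponent \<open>p / M\<close> in Cauchy's estimate requires.\<close>
  have "R \<le> enorm n (graph_map \<phi> (R, 0))"
  proof -
    have "\<bar>R\<bar>\<^sup>2 \<le> dot n (graph_map \<phi> (R, 0)) (graph_map \<phi> (R, 0))"
      using member_le_sum[of 1 "{1..n}" "\<lambda>i. graph_map \<phi> (R, 0) i * graph_map \<phi> (R, 0) i"] n
      unfolding dot_def by (simp add: graph_map_def power2_eq_square)
    then show ?thesis unfolding enorm_def using real_le_rsqrt by fastforce
  qed
  also have "\<dots> \<le> M" unfolding M_def using R by (intro enorm_le_C0_norm \<phi>) (auto simp: norm_Pair)
  finally have M: "0 < M" using R by linarith
  note jet = conformal_reparam_jet2[OF conf, folded S_def]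
  have jetN: "jet2 (ball 0 1) (\<lambda>z. dot n (Y z) (N 0)) (\<lambda>z. dot n (vdiff S 1 Y z) (N 0)) (\<lambda>z. dot n (vdiff S 2 Y z) (N 0))
      (\<lambda>z. dot n (vdiff2 S 1 1 Y z) (N 0)) (\<lambda>z. dot n (vdiff2 S 1 2 Y z) (N 0)) (\<lambda>z. dot n (vdiff2 S 2 2 Y z) (N 0))"
    unfolding dot_def by (rule jet2_linear_combination[OF jet])
  have harm: "dot n (vdiff2 S 1 1 Y z) (N 0) + dot n (vdiff2 S 2 2 Y z) (N 0) = 0" if z: "z \<in> ball 0 1" for z
  proof -
    have "(vdiff2 S 1 1 Y z i + vdiff2 S 2 2 Y z i) * N 0 i = 0" if "i \<in> {1..n}" for i
      using conformal_minimal_harmonic[OF n \<phi> minimal conf z that] by (simp add: S_def)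
    then have "(\<Sum>i=1..n. (vdiff2 S 1 1 Y z i + vdiff2 S 2 2 Y z i) * N 0 i) = 0" by (intro sum.neutral ballI)
    then show ?thesis unfolding dot_def by (simp only: sum.distrib distrib_right)
  qed
  obtain p where p: "p holomorphic_on ball 0 1" "\<And>z. z \<in> ball 0 1 \<Longrightarrow> Re (p z) = dot n (Y (Re z, Im z)) (N 0)"
    "deriv (deriv p) 0 = Complex (dot n (vdiff2 S 1 1 Y 0) (N 0)) (- dot n (vdiff2 S 1 2 Y 0) (N 0))"
    using harmonic_imp_holomorphic_real_part[OF jetN harm] by metis
  have "\<bar>Re (p z)\<bar> \<le> M" if z: "z \<in> ball 0 1" for z
  proof -
    have zr: "(Re z, Im z) \<in> cball 0 1" using z by (simp add: norm_Pair cmod_def less_imp_le)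
    have "\<bar>Re (p z)\<bar> \<le> enorm n (Y (Re z, Im z)) * enorm n (N 0)"
      unfolding p(2)[OF z] by (rule dot_le_enorm)
    also have "enorm n (N 0) = 1" using N unfolding unit_normal_section_def by simp
    also have "enorm n (Y (Re z, Im z)) = enorm n (graph_map \<phi> (F (Re z, Im z)))"
      unfolding enorm_def dot_def using conf zr unfolding conformal_reparam_def
      by (intro arg_cong[where f=sqrt] sum.cong) auto
    also have "\<dots> * 1 \<le> M"
      unfolding M_def mult_1_right using conf zr unfolding conformal_reparam_def bij_betw_def
      by (intro enorm_le_C0_norm \<phi>) auto
    finally show ?thesis .
  qed
  then have p2: "cmod (deriv (deriv p) 0) \<le> 396 * M"
    by (intro cauchy_second_derivative_of_bounded_real_part p(1) M)
  have "gauss_curvature n S Y N 0 = - (cmod (deriv (deriv p) 0))\<^sup>2 / W\<^sup>2"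
    using harm[of 0] unfolding gauss_curvature_def Lform_def W_def p(3) cmod_power2
    by (simp add: power2_eq_square eq_neg_iff_add_eq_0[symmetric] add_eq_0_iff)
  then have "\<bar>gauss_curvature n S Y N 0\<bar> = (cmod (deriv (deriv p) 0))\<^sup>2 / W\<^sup>2" by simp
  also have "\<dots> \<le> (396 * M)\<^sup>2 / (R\<^sup>2 / 288)\<^sup>2"
    using area_element_lower_bound[OF n R \<phi> minimal conf F0] R p2 unfolding W_def S_def
    by (intro frac_le power_mono) auto
  also have "\<dots> = (396 * 288)\<^sup>2 / R ^ 4 * M\<^sup>2"
    using R by (simp add: power_mult_distrib power_divide field_simps power_mult[symmetric])
  finally show ?thesis unfolding S_def M_def .
qed

theorem mainTheorem1:
  "\<exists>\<Theta>::real. 0 \<le> \<Theta> \<and>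
    (\<forall>(n::nat) (R::real) (\<phi>::nat \<Rightarrow> real \<times> real \<Rightarrow> real)
       (Y::real \<times> real \<Rightarrow> nat \<Rightarrow> real) (F::real \<times> real \<Rightarrow> real \<times> real)
       (N::real \<times> real \<Rightarrow> nat \<Rightarrow> real).
       3 \<le> n \<longrightarrow> 0 < R \<longrightarrow>
       (\<forall>s\<in>{1..n - 2}. Ck_on 3 (cball 0 R) (\<phi> s)) \<longrightarrow>
       minimal_surface n (cball 0 R) (graph_map \<phi>) \<longrightarrow>
       conformal_reparam n (cball 0 R) (graph_map \<phi>) (cball 0 1) Y F \<longrightarrow>
       F (0, 0) = (0, 0) \<longrightarrow>
       unit_normal_section n (cball 0 1) Y N \<longrightarrow>
       \<bar>gauss_curvature n (cball 0 1) Y N (0, 0)\<bar>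
         \<le> \<Theta> / R ^ 4 * (C0_norm n (cball 0 R) (graph_map \<phi>))\<^sup>2)"
proof (intro exI[of _ "(396 * 288)\<^sup>2"] conjI allI impI)
  fix n R \<phi> Y F N
  assume "3 \<le> n" "0 < R" "\<forall>s\<in>{1..n - 2}. Ck_on 3 (cball 0 R) (\<phi> s)"
    "minimal_surface n (cball 0 R) (graph_map \<phi>)"
    "conformal_reparam n (cball 0 R) (graph_map \<phi>) (cball 0 1) Y F"
    "F (0, 0) = (0, 0)" "unit_normal_section n (cball 0 1) Y N"
  then show "\<bar>gauss_curvature n (cball 0 1) Y N (0, 0)\<bar>
      \<le> (396 * 288)\<^sup>2 / R ^ 4 * (C0_norm n (cball 0 R) (graph_map \<phi>))\<^sup>2"
    using curvature_estimate[of n R \<phi> Y F N] by (simp add: zero_prod_def)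
qed simp

end
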